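(* Let $\overline{\Omega}=\Omega\cup\partial\Omega$ be a rectangular domain with boundary $\partial\Omega$. Let $f\in C^6(\overline{\Omega})$, let $u\in C^8(\overline{\Omega})$ be a solution of the Dirichlet problem $$\partial_x^2u+\partial_y^2u+K^2u=f\ \text{ in }\Omega,\qquad u=\Phi\ \text{ on }\partial\Omega,$$ and let $U_{i,j}$ be the solution of the difference scheme $\mathcal{L}_{i,j}U_{i,j}=F_{i,j}$ ($1\le i,j\le N-1$) with $U_{i,j}=\Phi(x_i,y_j)$ on $\partial\Omega_h$. Then for sufficiently small $Kh$ (i.e. there is $\varepsilon>0$ such that the following holds whenever $0<Kh<\varepsilon$) the scheme is sixth-order accurate: there is a constant $C$ independent of $h$ with $\max_{0\le i,j\le N}|u(x_i,y_j)-U_{i,j}|\le Ch^6$. Further, as the mesh size $h\to0$ with $Kh$ sufficiently small, the solution of the scheme converges to the solution of the boundary value problem, i.e. $\max_{0\le i,j\le N}|u(x_i,y_j)-U_{i,j}|\to0$.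
   Context: $\Omega=[a,b]\times[c,d]$ and $K$ is a constant (the wave number). The grid $\Omega_h$ consists of the points $(x_i,y_j)$, $x_i=a+ih$, $y_j=c+jh$, $0\le i,j\le N$ (with $x_N=b$, $y_N=d$); interior points are those with $1\le i,j\le N-1$, and $\partial\Omega_h$ is the set of boundary grid points. $\delta_x^2\varphi_{i,j}=\frac{\varphi_{i-1,j}-2\varphi_{i,j}+\varphi_{i+1,j}}{h^2}$, $\delta_y^2\varphi_{i,j}=\frac{\varphi_{i,j-1}-2\varphi_{i,j}+\varphi_{i,j+1}}{h^2}$, and $\delta_x^2\delta_y^2$ is their composition. The operator is $$\mathcal{L}=-\alpha_1(\delta_x^2+\delta_y^2)-\alpha_2\delta_x^2\delta_y^2-K^2\alpha_3$$ and $$F_{i,j}=-\beta_1f_{i,j}-\beta_2(\delta_x^2+\delta_y^2)f_{i,j}-\beta_3\delta_x^2\delta_y^2f_{i,j}-\beta_4(\partial_x^2+\partial_y^2)f_{i,j}-\beta_5(\delta_x^2\partial_x^2+\delta_y^2\partial_y^2)f_{i,j},$$ with $\alpha_1=1+\frac{K^6h^6}{20160}$, $\alpha_2=\frac{h^2}{6}\left(1+\frac{K^2h^2}{30}+\frac{K^4h^4}{840}\right)$, $\alpha_3=1-\frac{K^2h^2}{12}+\frac{K^4h^4}{360}$, $\beta_1=1-\frac{K^2h^2}{12}+\frac{K^4h^4}{360}$, $\beta_2=\frac{K^4h^6}{20160}$, $\beta_3=\frac{h^4}{90}\left(1+\frac{K^2h^2}{112}\right)$, $\beta_4=\frac{h^2}{12}\left(1-\frac{K^2h^2}{30}\right)$,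 $\beta_5=\frac{h^4}{360}\left(1-\frac{K^2h^2}{56}\right)$.
   Formalization: The solution u is additionally assumed to be the only C^8 solution of the Dirichlet problem; otherwise the claim fails, e.g. on [0,π]² with K²=2, f=0, Φ=0, u=sin x sin y, where U=0 solves the scheme for every h. *)

theory Defs
  imports "HOL-Analysis.Analysis"
begin

section \<open>Functions on the closed rectangle\<close>

text \<open>
  Partial derivatives of functions on the closed rectangle $[a,b]\times[c,d]$. They are taken
  within \<open>{a..b}\<close> and \<open>{c..d}\<close>: ordinary derivatives at interior points, one-sided at the
  endpoints. Only the values of the function on the rectangle matter.
\<close>

definition pdx :: "real \<Rightarrow> real \<Rightarrow> (real \<times> real \<Rightarrow> real) \<Rightarrow> real \<times> real \<Rightarrow> real" where
  "pdx a b g = (\<lambda>(x, y). vector_derivative (\<lambda>s. g (s, y)) (at x within {a..b}))"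

definition pdy :: "real \<Rightarrow> real \<Rightarrow> (real \<times> real \<Rightarrow> real) \<Rightarrow> real \<times> real \<Rightarrow> real" where
  "pdy c d g = (\<lambda>(x, y). vector_derivative (\<lambda>t. g (x, t)) (at y within {c..d}))"

text \<open>
  $C^k$ on the closed rectangle: all (mixed) partial derivatives up to order \<open>k\<close>
  exist and are continuous on the closed rectangle.
\<close>

primrec Ck_rect ::
  "nat \<Rightarrow> real \<Rightarrow> real \<Rightarrow> real \<Rightarrow> real \<Rightarrow> (real \<times> real \<Rightarrow> real) \<Rightarrow> bool" where
  "Ck_rect 0 a b c d g \<longleftrightarrow> continuous_on ({a..b} \<times> {c..d}) g"
| "Ck_rect (Suc k) a b c d g \<longleftrightarrow>
     continuous_on ({a..b} \<times> {c..d}) g \<and>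
     (\<forall>x\<in>{a..b}. \<forall>y\<in>{c..d}.
        (\<lambda>s. g (s, y)) differentiable (at x within {a..b}) \<and>
        (\<lambda>t. g (x, t)) differentiable (at y within {c..d})) \<and>
     Ck_rect k a b c d (pdx a b g) \<and>
     Ck_rect k a b c d (pdy c d g)"

definition pdx2 :: "real \<Rightarrow> real \<Rightarrow> (real \<times> real \<Rightarrow> real) \<Rightarrow> real \<times> real \<Rightarrow> real" where
  "pdx2 a b g = pdx a b (pdx a b g)"

definition pdy2 :: "real \<Rightarrow> real \<Rightarrow> (real \<times> real \<Rightarrow> real) \<Rightarrow> real \<times> real \<Rightarrow> real" where
  "pdy2 c d g = pdy c d (pdy c d g)"

definition helmholtz_dirichlet ::
  "real \<Rightarrow> real \<Rightarrow> real \<Rightarrow> real \<Rightarrow> real \<Rightarrow> (real \<times> real \<Rightarrow> real) \<Rightarrow> (real \<times> real \<Rightarrow> real) \<Rightarrow>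
   (real \<times> real \<Rightarrow> real) \<Rightarrow> bool" where
  "helmholtz_dirichlet a b c d K f \<Phi> u \<longleftrightarrow>
     Ck_rect 8 a b c d u \<and>
     (\<forall>p\<in>{a<..<b} \<times> {c<..<d}. pdx2 a b u p + pdy2 c d u p + K^2 * u p = f p) \<and>
     (\<forall>p\<in>frontier ({a..b} \<times> {c..d}). u p = \<Phi> p)"


section \<open>The difference scheme\<close>

definition uniform_grid :: "real \<Rightarrow> real \<Rightarrow> real \<Rightarrow> real \<Rightarrow> nat \<Rightarrow> real \<Rightarrow> bool" where
  "uniform_grid a b c d N h \<longleftrightarrow> h > 0 \<and> a + real N * h = b \<and> c + real N * h = d"

definition grid_point :: "real \<Rightarrow> real \<Rightarrow> real \<Rightarrow> nat \<Rightarrow> nat \<Rightarrow> real \<times> real" where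
  "grid_point a c h i j = (a + real i * h, c + real j * h)"

text \<open>
  The truncated subtractions are harmless: the difference operators are only used
  at interior indices $1 \le i,j \le N-1$.
\<close>

definition delta_x2 :: "real \<Rightarrow> (nat \<Rightarrow> nat \<Rightarrow> real) \<Rightarrow> nat \<Rightarrow> nat \<Rightarrow> real" where
  "delta_x2 h \<phi> i j = (\<phi> (i - 1) j - 2 * \<phi> i j + \<phi> (i + 1) j) / h^2"

definition delta_y2 :: "real \<Rightarrow> (nat \<Rightarrow> nat \<Rightarrow> real) \<Rightarrow> nat \<Rightarrow> nat \<Rightarrow> real" where
  "delta_y2 h \<phi> i j = (\<phi> i (j - 1) - 2 * \<phi> i j + \<phi> i (j + 1)) / h^2"

definition alpha1 :: "real \<Rightarrow> real \<Rightarrow> real" where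
  "alpha1 K h = 1 + K^6 * h^6 / 20160"

definition alpha2 :: "real \<Rightarrow> real \<Rightarrow> real" where
  "alpha2 K h = h^2 / 6 * (1 + K^2 * h^2 / 30 + K^4 * h^4 / 840)"

definition alpha3 :: "real \<Rightarrow> real \<Rightarrow> real" where
  "alpha3 K h = 1 - K^2 * h^2 / 12 + K^4 * h^4 / 360"

definition beta1 :: "real \<Rightarrow> real \<Rightarrow> real" where
  "beta1 K h = 1 - K^2 * h^2 / 12 + K^4 * h^4 / 360"

definition beta2 :: "real \<Rightarrow> real \<Rightarrow> real" where
  "beta2 K h = K^4 * h^6 / 20160"

definition beta3 :: "real \<Rightarrow> real \<Rightarrow> real" where
  "beta3 K h = h^4 / 90 * (1 + K^2 * h^2 / 112)"

definition beta4 :: "real \<Rightarrow> real \<Rightarrow> real" where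
  "beta4 K h = h^2 / 12 * (1 - K^2 * h^2 / 30)"

definition beta5 :: "real \<Rightarrow> real \<Rightarrow> real" where
  "beta5 K h = h^4 / 360 * (1 - K^2 * h^2 / 56)"

definition scheme_op :: "real \<Rightarrow> real \<Rightarrow> (nat \<Rightarrow> nat \<Rightarrow> real) \<Rightarrow> nat \<Rightarrow> nat \<Rightarrow> real" where
  "scheme_op K h U i j =
     - alpha1 K h * (delta_x2 h U i j + delta_y2 h U i j)
     - alpha2 K h * delta_x2 h (delta_y2 h U) i j
     - K^2 * alpha3 K h * U i j"

definition scheme_rhs ::
  "real \<Rightarrow> real \<Rightarrow> real \<Rightarrow> real \<Rightarrow> real \<Rightarrow> real \<Rightarrow> (real \<times> real \<Rightarrow> real) \<Rightarrow> nat \<Rightarrow> nat \<Rightarrow> real" where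
  "scheme_rhs a b c d K h f i j =
     (let fh = (\<lambda>i j. f (grid_point a c h i j));
          fxx = (\<lambda>i j. pdx2 a b f (grid_point a c h i j));
          fyy = (\<lambda>i j. pdy2 c d f (grid_point a c h i j))
      in - beta1 K h * fh i j
         - beta2 K h * (delta_x2 h fh i j + delta_y2 h fh i j)
         - beta3 K h * delta_x2 h (delta_y2 h fh) i j
         - beta4 K h * (fxx i j + fyy i j)
         - beta5 K h * (delta_x2 h fxx i j + delta_y2 h fyy i j))"

definition scheme_solution ::
  "real \<Rightarrow> real \<Rightarrow> real \<Rightarrow> real \<Rightarrow> real \<Rightarrow> (real \<times> real \<Rightarrow> real) \<Rightarrow> (real \<times> real \<Rightarrow> real) \<Rightarrow>
   nat \<Rightarrow> real \<Rightarrow> (nat \<Rightarrow> nat \<Rightarrow> real) \<Rightarrow> bool" where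
  "scheme_solution a b c d K f \<Phi> N h U \<longleftrightarrow>
     (\<forall>i\<in>{1..N-1}. \<forall>j\<in>{1..N-1}. scheme_op K h U i j = scheme_rhs a b c d K h f i j) \<and>
     (\<forall>i\<in>{0..N}. \<forall>j\<in>{0..N}. i = 0 \<or> i = N \<or> j = 0 \<or> j = N \<longrightarrow>
        U i j = \<Phi> (grid_point a c h i j))"

definition max_error ::
  "real \<Rightarrow> real \<Rightarrow> nat \<Rightarrow> real \<Rightarrow> (real \<times> real \<Rightarrow> real) \<Rightarrow> (nat \<Rightarrow> nat \<Rightarrow> real) \<Rightarrow> real" where
  "max_error a c N h u U =
     Max ((\<lambda>(i, j). \<bar>u (grid_point a c h i j) - U i j\<bar>) ` ({0..N} \<times> {0..N}))"

end

theory Submission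
  imports Defs
begin

text \<open>
  The error \<open>e = u - U\<close> on the grid vanishes at the boundary points, and at the interior points
  the difference operator maps it to the truncation error \<open>\<tau>\<close>, the defect of the exact
  solution in the scheme. The theorem follows from consistency, \<open>\<bar>\<tau>\<bar> \<le> T h\<^sup>6\<close>, and stability,
  \<open>max \<bar>e\<bar> \<le> C max \<bar>\<tau>\<bar>\<close>, with constants that do not depend on the grid.

  Consistency (\<open>truncation_error_sixth_order\<close>, \<open>scheme_consistency\<close>): by continuity the equation
  \<open>f = \<Delta>u + K\<^sup>2 u\<close> holds on the closed rectangle, so all derivatives of \<open>f\<close> in the scheme
  are derivatives of \<open>u\<close>. The Taylor expansion of the second differences turns the defect into
  a polynomial in \<open>h\<close> whose coefficients of order 0, 2 and 4 cancel identically; the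
  coefficients of the scheme are chosen for this. What is left is \<open>h\<^sup>6\<close> times a bounded quantity.

  Stability (\<open>scheme_stability\<close>): the grid fits both sides of the rectangle with the same number
  of steps, so the rectangle is a square of side \<open>L = N h\<close>, and the discrete sines are an
  orthogonal basis of eigenvectors of the scheme. Expanding \<open>e\<close> in this basis and applying
  Cauchy-Schwarz and Parseval bounds \<open>max \<bar>e\<bar>\<close> by \<open>max \<bar>\<tau>\<bar>\<close> times the root of the sum of the
  inverse squares of the eigenvalues. This sum is bounded uniformly in \<open>N\<close> once the eigenvalue
  with frequencies \<open>m, n\<close> is at least \<open>\<kappa> m n\<close> in absolute value.

  That lower bound (\<open>scheme_symbol_uniformly_elliptic\<close>) has two sources. For high
  frequencies the discrete Laplacian dominates \<open>K\<^sup>2\<close>. For each of the finitely many low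
  frequencies the eigenvalue tends to \<open>(m \<pi> / L)\<^sup>2 + (n \<pi> / L)\<^sup>2 - K\<^sup>2\<close> as \<open>h \<rightarrow> 0\<close>, and
  this limit is not 0 (\<open>uniqueness_imp_nonresonance\<close>): otherwise adding
  \<open>sin (m \<pi> (x - a) / L) sin (n \<pi> (y - c) / L)\<close> to \<open>u\<close> would give a second solution of the
  boundary value problem.
\<close>

section \<open>Partial derivatives on the closed rectangle\<close>

lemma has_real_derivative_within_cong:
  fixes f g :: "real \<Rightarrow> real"
  assumes "(f has_real_derivative D) (at x within S)" "x \<in> S" "\<And>s. s \<in> S \<Longrightarrow> f s = g s"
  shows "(g has_real_derivative D) (at x within S)"
  using has_derivative_transform[of x S g f "(*) D"] assms
  by (simp add: has_field_derivative_def)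

lemma pdx_eqI:
  assumes "a < b" "x \<in> {a..b}"
    and "((\<lambda>s. g (s, y)) has_real_derivative D) (at x within {a..b})"
  shows "pdx a b g (x, y) = D"
  using vector_derivative_within_cbox[of a b x "\<lambda>s. g (s, y)" D] assms
  by (simp add: pdx_def has_real_derivative_iff_has_vector_derivative)

lemma pdy_eqI:
  assumes "c < d" "y \<in> {c..d}"
    and "((\<lambda>t. g (x, t)) has_real_derivative D) (at y within {c..d})"
  shows "pdy c d g (x, y) = D"
  using vector_derivative_within_cbox[of c d y "\<lambda>t. g (x, t)" D] assms
  by (simp add: pdy_def has_real_derivative_iff_has_vector_derivative)

lemma Ck_rect_pdx:
  assumes "Ck_rect (Suc k) a b c d g" "x \<in> {a..b}" "y \<in> {c..d}"
  shows "((\<lambda>s. g (s, y)) has_real_derivative pdx a b g (x, y)) (at x within {a..b})"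
  using assms
  by (simp add: pdx_def has_real_derivative_iff_has_vector_derivative vector_derivative_works)

lemma Ck_rect_pdy:
  assumes "Ck_rect (Suc k) a b c d g" "x \<in> {a..b}" "y \<in> {c..d}"
  shows "((\<lambda>t. g (x, t)) has_real_derivative pdy c d g (x, y)) (at y within {c..d})"
  using assms
  by (simp add: pdy_def has_real_derivative_iff_has_vector_derivative vector_derivative_works)

lemma Ck_rect_continuous: "Ck_rect k a b c d g \<Longrightarrow> continuous_on ({a..b} \<times> {c..d}) g"
  by (cases k) auto

lemma Ck_rect_mono:
  "Ck_rect k a b c d g \<Longrightarrow> l \<le> k \<Longrightarrow> Ck_rect l a b c d g"
proof (induction l arbitrary: k g)
  case 0
  thus ?case by (simp add: Ck_rect_continuous)
next
  case (Suc l)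
  then obtain k' where "k = Suc k'" "l \<le> k'" by (cases k) auto
  thus ?case using Suc by auto
qed

lemma pdx_cong:
  assumes "\<And>p. p \<in> {a..b} \<times> {c..d} \<Longrightarrow> g p = g' p" "x \<in> {a..b}" "y \<in> {c..d}"
  shows "pdx a b g (x, y) = pdx a b g' (x, y)"
proof -
  have "((\<lambda>s. g (s, y)) has_real_derivative D) (at x within {a..b}) \<longleftrightarrow>
        ((\<lambda>s. g' (s, y)) has_real_derivative D) (at x within {a..b})" for D
    using assms by (intro iffI; elim has_real_derivative_within_cong) auto
  thus ?thesis by (simp add: pdx_def vector_derivative_def has_real_derivative_iff_has_vector_derivative)
qed

text \<open>
  Symmetry of the mixed derivatives up to the boundary. Write \<open>g (x, y)\<close> as \<open>g (x, c)\<close> plus the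
  integral of \<open>g\<^sub>y (x, t)\<close> over \<open>t\<close> from \<open>c\<close> to \<open>y\<close>. Differentiating under the integral gives \<open>g\<^sub>x\<close>
  as an integral of \<open>g\<^sub>y\<^sub>x\<close>, and the fundamental theorem then yields \<open>g\<^sub>x\<^sub>y = g\<^sub>y\<^sub>x\<close>. One-sided
  derivatives at the edges cause no extra case.
\<close>

lemma pdx_pdy_commute:
  assumes "a < b" "c < d" and C2: "Ck_rect (Suc (Suc k)) a b c d g"
    and x: "x \<in> {a..b}" and y: "y \<in> {c..d}"
  shows "pdy c d (pdx a b g) (x, y) = pdx a b (pdy c d g) (x, y)"
proof -
  let ?gy = "pdy c d g" and ?gyx = "pdx a b (pdy c d g)"
  have C1y: "Ck_rect (Suc k) a b c d ?gy" using C2 by simp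
  have cont_gyx: "continuous_on ({a..b} \<times> {c..d}) ?gyx"
    using C1y by (auto intro: Ck_rect_continuous)
  have cont_gy: "continuous_on ({a..b} \<times> {c..d}) ?gy"
    using C1y by (rule Ck_rect_continuous)
  have slice: "continuous_on {c..d} (\<lambda>t. \<phi> (s, t))"
    if "continuous_on ({a..b} \<times> {c..d}) \<phi>" "s \<in> {a..b}" for \<phi> :: "real \<times> real \<Rightarrow> real" and s
    by (rule continuous_on_compose2[OF that(1)]) (use that(2) in \<open>auto intro!: continuous_intros\<close>)
  have FTC: "g (s, t) = g (s, c) + integral {c..t} (\<lambda>r. ?gy (s, r))"
    if "s \<in> {a..b}" "t \<in> {c..d}" for s t
  proof -
    have "((\<lambda>r. ?gy (s, r)) has_integral g (s, t) - g (s, c)) {c..t}"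
    proof (rule fundamental_theorem_of_calculus)
      fix r assume "r \<in> {c..t}"
      hence "((\<lambda>t. g (s, t)) has_real_derivative ?gy (s, r)) (at r within {c..d})"
        using that by (intro Ck_rect_pdy[OF C2]) auto
      hence "((\<lambda>t. g (s, t)) has_real_derivative ?gy (s, r)) (at r within {c..t})"
        using that by (elim DERIV_subset) auto
      thus "((\<lambda>t. g (s, t)) has_vector_derivative ?gy (s, r)) (at r within {c..t})"
        by (simp add: has_real_derivative_iff_has_vector_derivative)
    qed (use that in auto)
    thus ?thesis by (simp add: integral_unique)
  qed
  have gx: "pdx a b g (x, t) = pdx a b g (x, c) + integral {c..t} (\<lambda>r. ?gyx (x, r))"
    if t: "t \<in> {c..d}" for t
  proof (rule pdx_eqI[OF \<open>a < b\<close> x])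
    have "((\<lambda>s. integral (cbox c t) (\<lambda>r. ?gy (s, r))) has_real_derivative
            integral (cbox c t) (\<lambda>r. ?gyx (x, r))) (at x within {a..b})"
    proof (rule leibniz_rule_field_derivative)
      show "((\<lambda>s. ?gy (s, r)) has_real_derivative ?gyx (s, r)) (at s within {a..b})"
        if "s \<in> {a..b}" "r \<in> cbox c t" for s r
        using that t by (intro Ck_rect_pdx[OF C1y]) auto
      show "(\<lambda>r. ?gy (s, r)) integrable_on cbox c t" if "s \<in> {a..b}" for s
      proof -
        have "continuous_on {c..t} (\<lambda>r. ?gy (s, r))"
          by (rule continuous_on_subset[OF slice[OF cont_gy that]]) (use t in auto)
        thus ?thesis by (simp add: integrable_continuous_real)
      qed
      have "continuous_on ({a..b} \<times> cbox c t) ?gyx"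
        using cont_gyx t by (elim continuous_on_subset) auto
      thus "continuous_on ({a..b} \<times> cbox c t) (\<lambda>(s, r). ?gyx (s, r))" by simp
    qed (use x in auto)
    from DERIV_add[OF Ck_rect_pdx[OF C2, of x c] this]
    have "((\<lambda>s. g (s, c) + integral {c..t} (\<lambda>r. ?gy (s, r))) has_real_derivative
            pdx a b g (x, c) + integral {c..t} (\<lambda>r. ?gyx (x, r))) (at x within {a..b})"
      using \<open>c < d\<close> x by simp
    thus "((\<lambda>s. g (s, t)) has_real_derivative
            pdx a b g (x, c) + integral {c..t} (\<lambda>r. ?gyx (x, r))) (at x within {a..b})"
      by (rule has_real_derivative_within_cong) (use t x in \<open>simp_all add: FTC[symmetric]\<close>)
  qed
  have "((\<lambda>t. pdx a b g (x, c) + integral {c..t} (\<lambda>r. ?gyx (x, r))) has_real_derivative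
          0 + ?gyx (x, y)) (at y within {c..d})"
    using y by (intro DERIV_add DERIV_const integral_has_real_derivative slice[OF cont_gyx x])
  hence "((\<lambda>t. pdx a b g (x, c) + integral {c..t} (\<lambda>r. ?gyx (x, r))) has_real_derivative
          ?gyx (x, y)) (at y within {c..d})"
    by simp
  hence "((\<lambda>t. pdx a b g (x, t)) has_real_derivative ?gyx (x, y)) (at y within {c..d})"
    by (rule has_real_derivative_within_cong) (use y in \<open>simp_all add: gx[symmetric]\<close>)
  thus ?thesis by (rule pdy_eqI[OF \<open>c < d\<close> y])
qed

text \<open>
  Smoothness is used through a family that behaves like the mixed partial derivatives
  \<open>\<partial>\<^sub>x\<^sup>k \<partial>\<^sub>y\<^sup>l g\<close>. This makes the order of differentiation immaterial and keeps Taylor expansions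
  free of iterated operators.
\<close>

definition partials_upto ::
  "nat \<Rightarrow> real \<Rightarrow> real \<Rightarrow> real \<Rightarrow> real \<Rightarrow> (nat \<Rightarrow> nat \<Rightarrow> real \<Rightarrow> real \<Rightarrow> real) \<Rightarrow> bool" where
  "partials_upto n a b c d G \<longleftrightarrow>
     (\<forall>k l. k + l < n \<longrightarrow> (\<forall>x\<in>{a..b}. \<forall>y\<in>{c..d}.
        ((\<lambda>s. G k l s y) has_real_derivative G (Suc k) l x y) (at x within {a..b}) \<and>
        ((\<lambda>t. G k l x t) has_real_derivative G k (Suc l) x y) (at y within {c..d})))"

lemma partials_uptoD:
  assumes "partials_upto n a b c d G" "k + l < n" "x \<in> {a..b}" "y \<in> {c..d}"
  shows partials_upto_x: "((\<lambda>s. G k l s y) has_real_derivative G (Suc k) l x y) (at x within {a..b})"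
    and partials_upto_y: "((\<lambda>t. G k l x t) has_real_derivative G k (Suc l) x y) (at y within {c..d})"
  using assms unfolding partials_upto_def by blast+

definition bounded_upto ::
  "nat \<Rightarrow> real \<Rightarrow> real \<Rightarrow> real \<Rightarrow> real \<Rightarrow> real \<Rightarrow> (nat \<Rightarrow> nat \<Rightarrow> real \<Rightarrow> real \<Rightarrow> real) \<Rightarrow> bool" where
  "bounded_upto n M a b c d G \<longleftrightarrow>
     (\<forall>k l. k + l \<le> n \<longrightarrow> (\<forall>x\<in>{a..b}. \<forall>y\<in>{c..d}. \<bar>G k l x y\<bar> \<le> M))"

text \<open>
  The derivatives in \<open>y\<close> are taken first; for smooth \<open>g\<close> any other order gives
  the same function on the rectangle, by symmetry of the mixed derivatives.
\<close>

definition mixed_partial ::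
  "real \<Rightarrow> real \<Rightarrow> real \<Rightarrow> real \<Rightarrow> (real \<times> real \<Rightarrow> real) \<Rightarrow> nat \<Rightarrow> nat \<Rightarrow> real \<Rightarrow> real \<Rightarrow> real" where
  "mixed_partial a b c d g k l x y = (pdx a b ^^ k) ((pdy c d ^^ l) g) (x, y)"

lemma Ck_rect_iterate:
  assumes "Ck_rect n a b c d g" "k + l \<le> n"
  shows "Ck_rect (n - (k + l)) a b c d ((pdx a b ^^ k) ((pdy c d ^^ l) g))"
proof -
  have y: "Ck_rect (n - l) a b c d ((pdy c d ^^ l) g)" if "l \<le> n" for l
    using that
  proof (induction l)
    case (Suc l)
    hence "Ck_rect (Suc (n - Suc l)) a b c d ((pdy c d ^^ l) g)"
      by (simp add: Suc_diff_Suc del: Ck_rect.simps)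
    thus ?case by simp
  qed (use assms in simp)
  show ?thesis using assms(2)
  proof (induction k)
    case (Suc k)
    hence "Ck_rect (Suc (n - (Suc k + l))) a b c d ((pdx a b ^^ k) ((pdy c d ^^ l) g))"
      by (simp add: Suc_diff_Suc del: Ck_rect.simps)
    thus ?case by simp
  qed (use y in simp)
qed

text \<open>
  A derivative in \<open>y\<close> is moved past the \<open>k\<close> derivatives in \<open>x\<close> one at a time.
\<close>

lemma pdy_iterate:
  assumes "a < b" "c < d" "Ck_rect n a b c d g" "k + l < n" "x \<in> {a..b}" "y \<in> {c..d}"
  shows "pdy c d ((pdx a b ^^ k) ((pdy c d ^^ l) g)) (x, y) = (pdx a b ^^ k) ((pdy c d ^^ Suc l) g) (x, y)"
  using assms(4-6)
proof (induction k arbitrary: x y)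
  case (Suc k)
  let ?G = "(pdx a b ^^ k) ((pdy c d ^^ l) g)"
  have "Ck_rect (Suc (Suc 0)) a b c d ?G"
    using Suc.prems by (intro Ck_rect_mono[OF Ck_rect_iterate[OF assms(3)]]) auto
  hence "pdy c d (pdx a b ?G) (x, y) = pdx a b (pdy c d ?G) (x, y)"
    by (rule pdx_pdy_commute[OF assms(1,2)]) (use Suc.prems in auto)
  also have "\<dots> = pdx a b ((pdx a b ^^ k) ((pdy c d ^^ Suc l) g)) (x, y)"
    by (rule pdx_cong) (use Suc in auto)
  finally show ?case by simp
qed simp

lemma mixed_partial_partials_upto:
  assumes "a < b" "c < d" "Ck_rect n a b c d g"
  shows "partials_upto n a b c d (mixed_partial a b c d g)"
  unfolding partials_upto_def
proof (intro allI impI ballI conjI)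
  fix k l x y assume kl: "k + l < n" and xy: "x \<in> {a..b}" "y \<in> {c..d}"
  let ?G = "(pdx a b ^^ k) ((pdy c d ^^ l) g)"
  have C1: "Ck_rect (Suc 0) a b c d ?G"
    using kl by (intro Ck_rect_mono[OF Ck_rect_iterate[OF assms(3)]]) auto
  show "((\<lambda>s. mixed_partial a b c d g k l s y) has_real_derivative
          mixed_partial a b c d g (Suc k) l x y) (at x within {a..b})"
    using Ck_rect_pdx[OF C1 xy] by (simp add: mixed_partial_def)
  show "((\<lambda>t. mixed_partial a b c d g k l x t) has_real_derivative
          mixed_partial a b c d g k (Suc l) x y) (at y within {c..d})"
    using Ck_rect_pdy[OF C1 xy] pdy_iterate[OF assms kl xy] by (simp add: mixed_partial_def)
qed

lemma mixed_partial_bounded_upto: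
  assumes "Ck_rect n a b c d g"
  obtains M where "bounded_upto n M a b c d (mixed_partial a b c d g)"
proof -
  let ?V = "\<lambda>k l. (pdx a b ^^ k) ((pdy c d ^^ l) g) ` ({a..b} \<times> {c..d})"
  have "bounded (?V k l)" if "k + l \<le> n" for k l
  proof -
    have "continuous_on ({a..b} \<times> {c..d}) ((pdx a b ^^ k) ((pdy c d ^^ l) g))"
      by (rule Ck_rect_continuous[OF Ck_rect_iterate[OF assms that]])
    thus ?thesis
      by (intro compact_imp_bounded compact_continuous_image compact_Times compact_Icc)
  qed
  moreover have "finite {(k, l). k + l \<le> n}"
    by (rule finite_subset[of _ "{..n} \<times> {..n}"]) auto
  ultimately have "bounded (\<Union>(k, l)\<in>{(k, l). k + l \<le> n}. ?V k l)"
    by (intro bounded_UN) auto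
  then obtain M where M: "\<And>v. v \<in> (\<Union>(k, l)\<in>{(k, l). k + l \<le> n}. ?V k l) \<Longrightarrow> \<bar>v\<bar> \<le> M"
    unfolding bounded_iff real_norm_def by blast
  have "bounded_upto n M a b c d (mixed_partial a b c d g)"
    unfolding bounded_upto_def
  proof (intro allI impI ballI)
    fix k l x y assume "k + l \<le> n" "x \<in> {a..b}" "y \<in> {c..d}"
    thus "\<bar>mixed_partial a b c d g k l x y\<bar> \<le> M"
      unfolding mixed_partial_def by (intro M UN_I[of "(k, l)"]) auto
  qed
  thus ?thesis by (rule that)
qed

lemma pdx_eq_partial:
  assumes "a < b" "partials_upto n a b c d G" "k + l < n"
    and "\<And>x y. x \<in> {a..b} \<Longrightarrow> y \<in> {c..d} \<Longrightarrow> g (x, y) = G k l x y"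
    and "x \<in> {a..b}" "y \<in> {c..d}"
  shows "pdx a b g (x, y) = G (Suc k) l x y"
  by (rule pdx_eqI[OF assms(1,5)],
      rule has_real_derivative_within_cong[OF partials_upto_x[OF assms(2,3,5,6)] assms(5)])
     (simp only: assms(4,6))

lemma pdy_eq_partial:
  assumes "c < d" "partials_upto n a b c d G" "k + l < n"
    and "\<And>x y. x \<in> {a..b} \<Longrightarrow> y \<in> {c..d} \<Longrightarrow> g (x, y) = G k l x y"
    and "x \<in> {a..b}" "y \<in> {c..d}"
  shows "pdy c d g (x, y) = G k (Suc l) x y"
  by (rule pdy_eqI[OF assms(1,6)],
      rule has_real_derivative_within_cong[OF partials_upto_y[OF assms(2,3,5,6)] assms(6)])
     (simp only: assms(4,5))

lemma pdx2_eq_partial: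
  assumes "a < b" "partials_upto n a b c d G" "k + l + 2 \<le> n"
    and "\<And>x y. x \<in> {a..b} \<Longrightarrow> y \<in> {c..d} \<Longrightarrow> g (x, y) = G k l x y"
    and "x \<in> {a..b}" "y \<in> {c..d}"
  shows "pdx2 a b g (x, y) = G (Suc (Suc k)) l x y"
  unfolding pdx2_def using assms(3)
  by (intro pdx_eq_partial[OF assms(1,2) _ _ assms(5,6)] pdx_eq_partial[OF assms(1,2) _ assms(4)]) auto

lemma pdy2_eq_partial:
  assumes "c < d" "partials_upto n a b c d G" "k + l + 2 \<le> n"
    and "\<And>x y. x \<in> {a..b} \<Longrightarrow> y \<in> {c..d} \<Longrightarrow> g (x, y) = G k l x y"
    and "x \<in> {a..b}" "y \<in> {c..d}"
  shows "pdy2 c d g (x, y) = G k (Suc (Suc l)) x y"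
  unfolding pdy2_def using assms(3)
  by (intro pdy_eq_partial[OF assms(1,2) _ _ assms(5,6)] pdy_eq_partial[OF assms(1,2) _ assms(4)]) auto

lemma mixed_partial_continuous:
  assumes "Ck_rect n a b c d g" "k + l \<le> n"
  shows "continuous_on ({a..b} \<times> {c..d}) (\<lambda>p. mixed_partial a b c d g k l (fst p) (snd p))"
  unfolding mixed_partial_def prod.collapse
  by (rule Ck_rect_continuous[OF Ck_rect_iterate[OF assms]])

text \<open>
  The converse passage, from a family of partial derivatives to \<open>C\<^sup>j\<close>: since the entry \<open>(k, l)\<close> is
  arbitrary, the induction on \<open>j\<close> can apply the hypothesis to both first derivatives of \<open>g\<close>.
\<close>

lemma Ck_rect_of_partials:
  assumes "a < b" "c < d" and G: "partials_upto n a b c d G"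
    and cont: "\<And>k l. k + l \<le> n \<Longrightarrow> continuous_on ({a..b} \<times> {c..d}) (\<lambda>p. G k l (fst p) (snd p))"
    and "k + l + j \<le> n"
    and "\<And>x y. x \<in> {a..b} \<Longrightarrow> y \<in> {c..d} \<Longrightarrow> g (x, y) = G k l x y"
  shows "Ck_rect j a b c d g"
  using assms(5,6)
proof (induction j arbitrary: k l g)
  case (0 k l g)
  have "continuous_on ({a..b} \<times> {c..d}) g \<longleftrightarrow>
        continuous_on ({a..b} \<times> {c..d}) (\<lambda>p. G k l (fst p) (snd p))"
    by (rule continuous_on_cong[OF refl]) (use 0 in force)
  thus ?case using cont[of k l] 0 by simp
next
  case (Suc j k l g)
  have kl: "k + l < n" using Suc.prems(1) by simp
  have "continuous_on ({a..b} \<times> {c..d}) g \<longleftrightarrow>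
        continuous_on ({a..b} \<times> {c..d}) (\<lambda>p. G k l (fst p) (snd p))"
    by (rule continuous_on_cong[OF refl]) (use Suc.prems(2) in force)
  hence "continuous_on ({a..b} \<times> {c..d}) g" using cont[of k l] kl by simp
  moreover have "(\<lambda>s. g (s, y)) differentiable (at x within {a..b}) \<and>
      (\<lambda>t. g (x, t)) differentiable (at y within {c..d})"
    if xy: "x \<in> {a..b}" "y \<in> {c..d}" for x y
  proof
    have "((\<lambda>s. g (s, y)) has_real_derivative G (Suc k) l x y) (at x within {a..b})"
      by (rule has_real_derivative_within_cong[OF partials_upto_x[OF G kl xy] xy(1)])
         (simp only: Suc.prems(2) xy)
    thus "(\<lambda>s. g (s, y)) differentiable (at x within {a..b})"
      unfolding has_field_derivative_def differentiable_def by blast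
    have "((\<lambda>t. g (x, t)) has_real_derivative G k (Suc l) x y) (at y within {c..d})"
      by (rule has_real_derivative_within_cong[OF partials_upto_y[OF G kl xy] xy(2)])
         (simp only: Suc.prems(2) xy)
    thus "(\<lambda>t. g (x, t)) differentiable (at y within {c..d})"
      unfolding has_field_derivative_def differentiable_def by blast
  qed
  moreover have "Ck_rect j a b c d (pdx a b g)"
    by (rule Suc.IH[of "Suc k" l])
       (use Suc.prems(1) pdx_eq_partial[OF \<open>a < b\<close> G kl Suc.prems(2)] in auto)
  moreover have "Ck_rect j a b c d (pdy c d g)"
    by (rule Suc.IH[of k "Suc l"])
       (use Suc.prems(1) pdy_eq_partial[OF \<open>c < d\<close> G kl Suc.prems(2)] in auto)
  ultimately show ?case unfolding Ck_rect.simps by blast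
qed


section \<open>Second differences of smooth functions\<close>

definition second_difference :: "real \<Rightarrow> (real \<Rightarrow> real) \<Rightarrow> real \<Rightarrow> real" where
  "second_difference h \<phi> x = (\<phi> (x - h) - 2 * \<phi> x + \<phi> (x + h)) / h\<^sup>2"

text \<open>
  Adding the Taylor expansions at \<open>x + h\<close> and \<open>x - h\<close> cancels the odd terms. The constant is
  not sharp; only the power of \<open>h\<close> matters.
\<close>

lemma second_difference_Taylor:
  fixes g :: "nat \<Rightarrow> real \<Rightarrow> real"
  assumes "h > 0" and I: "x - h \<in> {a..b}" "x + h \<in> {a..b}"
    and deriv: "\<And>i s. i \<le> 2 * p + 1 \<Longrightarrow> s \<in> {a..b} \<Longrightarrow>
           (g i has_real_derivative g (Suc i) s) (at s within {a..b})"
    and bound: "\<And>s. s \<in> {a..b} \<Longrightarrow> \<bar>g (2 * p + 2) s\<bar> \<le> M"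
  shows "\<bar>second_difference h (g 0) x - (\<Sum>j<p. 2 * h ^ (2 * j) / fact (2 * j + 2) * g (2 * j + 2) x)\<bar>
       \<le> 2 * M * h ^ (2 * p)"
proof -
  have x: "x \<in> {a..b}" using I \<open>h > 0\<close> by auto
  define T where "T z = (\<Sum>i\<le>2*p+1. g i x * z ^ i / fact i)" for z
  have M0: "M \<ge> 0" using bound[OF x] by linarith
  have taylor: "\<bar>g 0 (x + z) - T z\<bar> \<le> M * h ^ (2 * p + 2)"
    if "\<bar>z\<bar> = h" "x + z \<in> {a..b}" for z
  proof -
    have "norm (g 0 (x + z) - (\<Sum>i\<le>2*p+1. g i x * (x + z - x) ^ i / fact i))
        \<le> M * norm (x + z - x) ^ Suc (2*p+1) / fact (2*p+1)"
      by (rule field_Taylor[of "{a..b}"]) (use deriv bound x that in auto)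
    hence "\<bar>g 0 (x + z) - T z\<bar> \<le> M * h ^ (2 * p + 2) / fact (2*p+1)"
      using that by (simp add: T_def)
    also have "\<dots> \<le> M * h ^ (2 * p + 2) / 1"
      using M0 \<open>h > 0\<close> by (intro divide_left_mono fact_ge_1) (simp_all del: fact_Suc)
    finally show ?thesis by simp
  qed
  have even_part: "(\<Sum>i\<le>2*p+1. g i x * h ^ i / fact i) + (\<Sum>i\<le>2*p+1. g i x * (- h) ^ i / fact i)
      = 2 * g 0 x + h\<^sup>2 * (\<Sum>j<p. 2 * h ^ (2 * j) / fact (2 * j + 2) * g (2 * j + 2) x)" for p
  proof (induction p)
    case (Suc p)
    have *: "2 * Suc p + 1 = Suc (Suc (2 * p + 1))" by simp
    show ?case
      unfolding * using Suc
      by (simp add: power2_eq_square algebra_simps del: fact_Suc)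
  qed simp
  let ?S = "\<Sum>j<p. 2 * h ^ (2 * j) / fact (2 * j + 2) * g (2 * j + 2) x"
  have "h\<^sup>2 * (second_difference h (g 0) x - ?S)
      = (g 0 (x + h) - T h) + (g 0 (x + - h) - T (- h))"
    using even_part[of p] \<open>h > 0\<close>
    by (simp add: second_difference_def T_def right_diff_distrib)
  also have "\<bar>\<dots>\<bar> \<le> M * h ^ (2 * p + 2) + M * h ^ (2 * p + 2)"
    by (intro order.trans[OF abs_triangle_ineq] add_mono taylor) (use I \<open>h > 0\<close> in auto)
  also have "\<dots> = h\<^sup>2 * (2 * M * h ^ (2 * p))"
    by (simp add: power_add power2_eq_square)
  finally have "h\<^sup>2 * \<bar>second_difference h (g 0) x - ?S\<bar> \<le> h\<^sup>2 * (2 * M * h ^ (2 * p))"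
    by (simp add: abs_mult)
  thus ?thesis using \<open>h > 0\<close> by (elim mult_left_le_imp_le) simp
qed

lemma second_difference_x_partials:
  assumes G: "partials_upto n a b c d G" "bounded_upto n M a b c d G" "k + l + 2 * p + 2 \<le> n"
    and "h > 0" and "x - h \<in> {a..b}" "x + h \<in> {a..b}" "y \<in> {c..d}"
  shows "\<bar>second_difference h (\<lambda>s. G k l s y) x
           - (\<Sum>j<p. 2 * h ^ (2 * j) / fact (2 * j + 2) * G (k + (2 * j + 2)) l x y)\<bar> \<le> 2 * M * h ^ (2 * p)"
  using second_difference_Taylor[of h x a b p "\<lambda>i s. G (k + i) l s y" M] assms
  by (simp add: partials_upto_def bounded_upto_def)

lemma second_difference_y_partials:
  assumes G: "partials_upto n a b c d G" "bounded_upto n M a b c d G" "k + l + 2 * p + 2 \<le> n"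
    and "h > 0" and "x \<in> {a..b}" "y - h \<in> {c..d}" "y + h \<in> {c..d}"
  shows "\<bar>second_difference h (G k l x) y
           - (\<Sum>j<p. 2 * h ^ (2 * j) / fact (2 * j + 2) * G k (l + (2 * j + 2)) x y)\<bar> \<le> 2 * M * h ^ (2 * p)"
  using second_difference_Taylor[of h y c d p "\<lambda>i. G k (l + i) x" M] assms
  by (simp add: partials_upto_def bounded_upto_def)

lemma second_difference_abs_le:
  assumes "h > 0" "\<bar>\<phi> (x - h)\<bar> \<le> B" "\<bar>\<phi> x\<bar> \<le> B" "\<bar>\<phi> (x + h)\<bar> \<le> B"
  shows "\<bar>second_difference h \<phi> x\<bar> \<le> 4 * B / h\<^sup>2"
proof -
  have "\<bar>\<phi> (x - h) - 2 * \<phi> x + \<phi> (x + h)\<bar> \<le> 4 * B"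
    using assms by linarith
  thus ?thesis using \<open>h > 0\<close>
    by (simp add: second_difference_def abs_div divide_right_mono)
qed

lemma second_difference_linear:
  "second_difference h (\<lambda>s. p * \<phi> s + \<psi> s) x = p * second_difference h \<phi> x + second_difference h \<psi> x"
  by (simp add: second_difference_def field_simps add_divide_distrib diff_divide_distrib)

text \<open>
  The difference in \<open>y\<close> is expanded up to a remainder \<open>R = O(h\<^sup>6)\<close>, and then the difference in
  \<open>x\<close> is applied to each term. A second difference of \<open>R\<close> loses only the factor \<open>h\<^sup>2\<close>, so no
  derivatives of \<open>R\<close> are needed and eight derivatives of \<open>G 0 0\<close> suffice.
\<close>

lemma mixed_second_difference_fourth_order:
  assumes G: "partials_upto 8 a b c d G" "bounded_upto 8 M a b c d G"
    and "h > 0" and I: "x - h \<in> {a..b}" "x + h \<in> {a..b}" "y - h \<in> {c..d}" "y + h \<in> {c..d}"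
  shows "\<bar>second_difference h (\<lambda>s. second_difference h (G 0 0 s) y) x
           - (G 2 2 x y + h\<^sup>2 / 12 * (G 4 2 x y + G 2 4 x y))\<bar> \<le> 20 * M * h ^ 4"
proof -
  have y: "y \<in> {c..d}" and x: "x \<in> {a..b}" using I \<open>h > 0\<close> by auto
  define R where "R s = second_difference h (G 0 0 s) y
      - (G 0 2 s y + h\<^sup>2 / 12 * G 0 4 s y + h ^ 4 / 360 * G 0 6 s y)" for s
  have R: "\<bar>R s\<bar> \<le> 2 * M * h ^ 6" if "s \<in> {a..b}" for s
    using second_difference_y_partials[OF G, of 0 0 3 h s y] that I \<open>h > 0\<close>
    by (simp add: R_def lessThan_Suc eval_nat_numeral fact_numeral algebra_simps)
  let ?D = "\<lambda>\<phi>. second_difference h \<phi> x"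
  have M0: "M \<ge> 0" using G(2) x y unfolding bounded_upto_def by (smt (verit) le0 add_0)
  have "?D (\<lambda>s. second_difference h (G 0 0 s) y)
      = ?D (\<lambda>s. h\<^sup>2 / 12 * G 0 4 s y + (h ^ 4 / 360 * G 0 6 s y + (1 * R s + G 0 2 s y)))"
    by (simp add: R_def)
  also have "\<dots> = h\<^sup>2 / 12 * ?D (\<lambda>s. G 0 4 s y) + h ^ 4 / 360 * ?D (\<lambda>s. G 0 6 s y) + ?D R + ?D (\<lambda>s. G 0 2 s y)"
    by (simp only: second_difference_linear)
  finally have eq: "?D (\<lambda>s. second_difference h (G 0 0 s) y) - (G 2 2 x y + h\<^sup>2 / 12 * (G 4 2 x y + G 2 4 x y))
      = (?D (\<lambda>s. G 0 2 s y) - (G 2 2 x y + h\<^sup>2 / 12 * G 4 2 x y))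
      + h\<^sup>2 / 12 * (?D (\<lambda>s. G 0 4 s y) - G 2 4 x y) + h ^ 4 / 360 * ?D (\<lambda>s. G 0 6 s y) + ?D R"
    by (simp add: algebra_simps)
  have 1: "\<bar>?D (\<lambda>s. G 0 2 s y) - (G 2 2 x y + h\<^sup>2 / 12 * G 4 2 x y)\<bar> \<le> 2 * M * h ^ 4"
    using second_difference_x_partials[OF G, of 0 2 2 h x y] I y \<open>h > 0\<close>
    by (simp add: lessThan_Suc eval_nat_numeral algebra_simps)
  have 2: "\<bar>?D (\<lambda>s. G 0 4 s y) - G 2 4 x y\<bar> \<le> 2 * M * h ^ 2"
    using second_difference_x_partials[OF G, of 0 4 1 h x y] I y \<open>h > 0\<close>
    by (simp add: lessThan_Suc eval_nat_numeral algebra_simps)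
  have 3: "\<bar>?D (\<lambda>s. G 0 6 s y)\<bar> \<le> 2 * M"
    using second_difference_x_partials[OF G, of 0 6 0 h x y] I y \<open>h > 0\<close> by simp
  have 4: "\<bar>?D R\<bar> \<le> 4 * (2 * M * h ^ 6) / h\<^sup>2"
    by (intro second_difference_abs_le R) (use I x \<open>h > 0\<close> in auto)
  hence 4: "\<bar>?D R\<bar> \<le> 8 * M * h ^ 4"
    using \<open>h > 0\<close> by (simp add: power2_eq_square eval_nat_numeral)
  have "\<bar>h\<^sup>2 / 12 * (?D (\<lambda>s. G 0 4 s y) - G 2 4 x y)\<bar> \<le> h\<^sup>2 / 12 * (2 * M * h ^ 2)"
    unfolding abs_mult by (intro mult_mono 2) simp_all
  also have "\<dots> \<le> M * h ^ 4" using M0 \<open>h > 0\<close> by (simp add: eval_nat_numeral)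
  finally have 2: "\<bar>h\<^sup>2 / 12 * (?D (\<lambda>s. G 0 4 s y) - G 2 4 x y)\<bar> \<le> M * h ^ 4" .
  have "\<bar>h ^ 4 / 360 * ?D (\<lambda>s. G 0 6 s y)\<bar> \<le> h ^ 4 / 360 * (2 * M)"
    unfolding abs_mult by (intro mult_mono 3) simp_all
  also have "\<dots> \<le> M * h ^ 4" using M0 \<open>h > 0\<close> by simp
  finally have 3: "\<bar>h ^ 4 / 360 * ?D (\<lambda>s. G 0 6 s y)\<bar> \<le> M * h ^ 4" .
  have "0 \<le> M * h ^ 4" using M0 \<open>h > 0\<close> by simp
  thus ?thesis unfolding eq using 1 2 3 4 by linarith
qed

text \<open>
  The same argument two orders lower. It serves the right-hand side \<open>f\<close>, which has only six
  derivatives, and whose mixed difference carries a coefficient of size \<open>h\<^sup>4\<close>.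
\<close>

lemma mixed_second_difference_second_order:
  assumes G: "partials_upto 6 a b c d G" "bounded_upto 6 M a b c d G"
    and "h > 0" and I: "x - h \<in> {a..b}" "x + h \<in> {a..b}" "y - h \<in> {c..d}" "y + h \<in> {c..d}"
  shows "\<bar>second_difference h (\<lambda>s. second_difference h (G 0 0 s) y) x - G 2 2 x y\<bar> \<le> 20 * M * h\<^sup>2"
proof -
  have y: "y \<in> {c..d}" and x: "x \<in> {a..b}" using I \<open>h > 0\<close> by auto
  define R where "R s = second_difference h (G 0 0 s) y - (G 0 2 s y + h\<^sup>2 / 12 * G 0 4 s y)" for s
  have R: "\<bar>R s\<bar> \<le> 2 * M * h ^ 4" if "s \<in> {a..b}" for s
    using second_difference_y_partials[OF G, of 0 0 2 h s y] that I \<open>h > 0\<close>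
    by (simp add: R_def lessThan_Suc eval_nat_numeral algebra_simps)
  let ?D = "\<lambda>\<phi>. second_difference h \<phi> x"
  have M0: "M \<ge> 0" using G(2) x y unfolding bounded_upto_def by (smt (verit) le0 add_0)
  have "?D (\<lambda>s. second_difference h (G 0 0 s) y)
      = ?D (\<lambda>s. h\<^sup>2 / 12 * G 0 4 s y + (1 * R s + G 0 2 s y))"
    by (simp add: R_def)
  also have "\<dots> = h\<^sup>2 / 12 * ?D (\<lambda>s. G 0 4 s y) + ?D R + ?D (\<lambda>s. G 0 2 s y)"
    by (simp only: second_difference_linear)
  finally have eq: "?D (\<lambda>s. second_difference h (G 0 0 s) y) - G 2 2 x y
      = (?D (\<lambda>s. G 0 2 s y) - G 2 2 x y) + h\<^sup>2 / 12 * ?D (\<lambda>s. G 0 4 s y) + ?D R"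
    by (simp add: algebra_simps)
  have 1: "\<bar>?D (\<lambda>s. G 0 2 s y) - G 2 2 x y\<bar> \<le> 2 * M * h\<^sup>2"
    using second_difference_x_partials[OF G, of 0 2 1 h x y] I y \<open>h > 0\<close>
    by (simp add: lessThan_Suc eval_nat_numeral algebra_simps)
  have 2: "\<bar>?D (\<lambda>s. G 0 4 s y)\<bar> \<le> 2 * M"
    using second_difference_x_partials[OF G, of 0 4 0 h x y] I y \<open>h > 0\<close> by simp
  have 3: "\<bar>?D R\<bar> \<le> 4 * (2 * M * h ^ 4) / h\<^sup>2"
    by (intro second_difference_abs_le R) (use I x \<open>h > 0\<close> in auto)
  hence 3: "\<bar>?D R\<bar> \<le> 8 * M * h\<^sup>2"
    using \<open>h > 0\<close> by (simp add: power2_eq_square eval_nat_numeral)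
  have "\<bar>h\<^sup>2 / 12 * ?D (\<lambda>s. G 0 4 s y)\<bar> \<le> h\<^sup>2 / 12 * (2 * M)"
    unfolding abs_mult by (intro mult_mono 2) simp_all
  also have "\<dots> \<le> M * h\<^sup>2" using M0 \<open>h > 0\<close> by simp
  finally have 2: "\<bar>h\<^sup>2 / 12 * ?D (\<lambda>s. G 0 4 s y)\<bar> \<le> M * h\<^sup>2" .
  have "0 \<le> M * h\<^sup>2" using M0 \<open>h > 0\<close> by simp
  thus ?thesis unfolding eq using 1 2 3 by linarith
qed


section \<open>Truncation error\<close>

lemma square_times_sixth_power: "h\<^sup>2 * (z * h ^ 6) = z * (h :: real) ^ 8"
  by (simp add: eval_nat_numeral)

text \<open>
  The algebraic core of sixth order accuracy. The \<open>u\<^sub>k\<^sub>l\<close> stand for \<open>\<partial>\<^sub>x\<^sup>k \<partial>\<^sub>y\<^sup>l u\<close> at a grid point, the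
  \<open>f\<^sub>k\<^sub>l\<close> for those of \<open>f = \<Delta>u + K\<^sup>2 u\<close>, and \<open>dx\<close>, \<open>dy\<close>, \<open>dxy\<close> for the second differences of \<open>u\<close>
  with scaled Taylor remainders \<open>r\<close>. The values \<open>q1\<close>, \<open>q2\<close> are the second differences of \<open>f\<close>
  themselves, since their coefficient is already of order \<open>h\<^sup>6\<close>; \<open>q3\<close>, \<open>q4\<close>, \<open>q5\<close> are the scaled
  remainders of its other differences. All terms of order below 6 in \<open>h\<close> cancel.
\<close>

lemma truncation_identity:
  fixes h K u u20 u02 u40 u22 u04 u60 u42 u24 u06 r1 r2 r3 q1 q2 q3 q4 q5 :: real
  defines "f00 \<equiv> u20 + u02 + K\<^sup>2 * u"
    and "f20 \<equiv> u40 + u22 + K\<^sup>2 * u20" and "f02 \<equiv> u22 + u04 + K\<^sup>2 * u02"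
    and "f40 \<equiv> u60 + u42 + K\<^sup>2 * u40" and "f22 \<equiv> u42 + u24 + K\<^sup>2 * u22"
    and "f04 \<equiv> u24 + u06 + K\<^sup>2 * u04"
    and "dx \<equiv> u20 + h\<^sup>2 / 12 * u40 + h ^ 4 / 360 * u60 + h ^ 6 * r1"
    and "dy \<equiv> u02 + h\<^sup>2 / 12 * u04 + h ^ 4 / 360 * u06 + h ^ 6 * r2"
    and "dxy \<equiv> u22 + h\<^sup>2 / 12 * (u42 + u24) + h ^ 4 * r3"
  shows "- alpha1 K h * (dx + dy) - alpha2 K h * dxy - K\<^sup>2 * alpha3 K h * u
     - (- beta1 K h * f00 - beta2 K h * (q1 + q2) - beta3 K h * (f22 + h\<^sup>2 * q3)
        - beta4 K h * (f20 + f02) - beta5 K h * ((f40 + h\<^sup>2 * q4) + (f04 + h\<^sup>2 * q5)))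
     = - (h ^ 6) * (r1 + r2 + K ^ 6 / 20160 * (dx + dy)
         + 1 / 6 * (1 + K\<^sup>2 * h\<^sup>2 / 30 + K ^ 4 * h ^ 4 / 840) * r3
         + K\<^sup>2 / 2160 * (u42 + u24) + K ^ 4 / 5040 * (u22 + h\<^sup>2 / 12 * (u42 + u24))
         - K ^ 4 / 20160 * (q1 + q2) - 1 / 90 * (1 + K\<^sup>2 * h\<^sup>2 / 112) * q3 - K\<^sup>2 / 10080 * f22
         - 1 / 360 * (1 - K\<^sup>2 * h\<^sup>2 / 56) * (q4 + q5) + K\<^sup>2 / 20160 * (f40 + f04))"
  unfolding alpha1_def alpha2_def alpha3_def beta1_def beta2_def beta3_def beta4_def beta5_def
    f00_def f20_def f02_def f40_def f22_def f04_def dxy_def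
  unfolding dx_def dy_def
  by (simp add: algebra_simps add_divide_distrib diff_divide_distrib square_times_sixth_power)

text \<open>
  The bound has to be uniform in the mesh size and the grid point. Since bounded functions
  of \<open>(h, x, y)\<close> are closed under the ring operations, the remaining factor in the truncation
  error is bounded as soon as its ingredients are, and no explicit constant has to be found.
\<close>

definition bounded_on_mesh ::
  "(real \<Rightarrow> real \<Rightarrow> real \<Rightarrow> bool) \<Rightarrow> (real \<Rightarrow> real \<Rightarrow> real \<Rightarrow> real) \<Rightarrow> bool" where
  "bounded_on_mesh S e \<longleftrightarrow> (\<exists>B. \<forall>h x y. S h x y \<longrightarrow> \<bar>e h x y\<bar> \<le> B)"

lemma bounded_on_meshI:
  "(\<And>h x y. S h x y \<Longrightarrow> \<bar>e h x y\<bar> \<le> B) \<Longrightarrow> bounded_on_mesh S e"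
  by (auto simp: bounded_on_mesh_def)

lemma bounded_on_mesh_quotient:
  assumes "\<And>h x y. S h x y \<Longrightarrow> \<bar>e h x y\<bar> \<le> B * h ^ n" "\<And>h x y. S h x y \<Longrightarrow> h > 0"
  shows "bounded_on_mesh S (\<lambda>h x y. e h x y / h ^ n)"
proof (rule bounded_on_meshI)
  fix h x y assume S: "S h x y"
  thus "\<bar>e h x y / h ^ n\<bar> \<le> B" 
    using assms(1)[OF S] assms(2)[OF S] by (simp add: abs_div pos_divide_le_eq)
qed

lemma bounded_on_mesh_const: "bounded_on_mesh S (\<lambda>h x y. c)"
  by (auto simp: bounded_on_mesh_def)

lemma bounded_on_mesh_add:
  assumes "bounded_on_mesh S e" "bounded_on_mesh S e'"
  shows "bounded_on_mesh S (\<lambda>h x y. e h x y + e' h x y)"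
proof -
  obtain A B where "\<And>h x y. S h x y \<Longrightarrow> \<bar>e h x y\<bar> \<le> A" "\<And>h x y. S h x y \<Longrightarrow> \<bar>e' h x y\<bar> \<le> B"
    using assms unfolding bounded_on_mesh_def by blast
  thus ?thesis by (intro bounded_on_meshI[of _ _ "A + B"]) (smt (verit))
qed

lemma bounded_on_mesh_mult:
  assumes "bounded_on_mesh S e" "bounded_on_mesh S e'"
  shows "bounded_on_mesh S (\<lambda>h x y. e h x y * e' h x y)"
proof -
  obtain A B where AB: "\<And>h x y. S h x y \<Longrightarrow> \<bar>e h x y\<bar> \<le> A" "\<And>h x y. S h x y \<Longrightarrow> \<bar>e' h x y\<bar> \<le> B"
    using assms unfolding bounded_on_mesh_def by blast
  show ?thesis
  proof (rule bounded_on_meshI)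
    fix h x y assume S: "S h x y"
    show "\<bar>e h x y * e' h x y\<bar> \<le> A * B"
      unfolding abs_mult by (rule mult_mono[OF AB(1)[OF S] AB(2)[OF S]]) (use AB(1)[OF S] in auto)
  qed
qed

lemma bounded_on_mesh_diff:
  assumes "bounded_on_mesh S e" "bounded_on_mesh S e'"
  shows "bounded_on_mesh S (\<lambda>h x y. e h x y - e' h x y)"
  using bounded_on_mesh_add[OF assms(1) bounded_on_mesh_mult[OF bounded_on_mesh_const[of S "-1"] assms(2)]]
  by simp

lemma bounded_on_mesh_power:
  assumes "bounded_on_mesh S e"
  shows "bounded_on_mesh S (\<lambda>h x y. e h x y ^ n)"
  by (induction n) (simp_all add: bounded_on_mesh_const bounded_on_mesh_mult[OF assms])

lemma bounded_on_mesh_divide_const: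
  assumes "bounded_on_mesh S e"
  shows "bounded_on_mesh S (\<lambda>h x y. e h x y / c)"
  using bounded_on_mesh_mult[OF assms bounded_on_mesh_const[of S "1 / c"]] by simp

lemmas bounded_on_mesh_intros =
  bounded_on_mesh_const bounded_on_mesh_add bounded_on_mesh_diff bounded_on_mesh_mult
  bounded_on_mesh_power bounded_on_mesh_divide_const

text \<open>
  The nine points of the difference stencil around \<open>(x, y)\<close> lie in the rectangle.
\<close>

definition mesh_square :: "real \<Rightarrow> real \<Rightarrow> real \<Rightarrow> real \<Rightarrow> real \<Rightarrow> real \<Rightarrow> real \<Rightarrow> bool" where
  "mesh_square a b c d h x y \<longleftrightarrow>
     0 < h \<and> x - h \<in> {a..b} \<and> x + h \<in> {a..b} \<and> y - h \<in> {c..d} \<and> y + h \<in> {c..d}"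

text \<open>
  If \<open>G\<close> is the family of partial derivatives of \<open>g\<close>, this is that of \<open>\<Delta>g + K\<^sup>2 g\<close>.
\<close>

definition helmholtz_family ::
  "real \<Rightarrow> (nat \<Rightarrow> nat \<Rightarrow> real \<Rightarrow> real \<Rightarrow> real) \<Rightarrow> nat \<Rightarrow> nat \<Rightarrow> real \<Rightarrow> real \<Rightarrow> real" where
  "helmholtz_family K G k l x y = G (k + 2) l x y + G k (l + 2) x y + K\<^sup>2 * G k l x y"

lemma helmholtz_family_partials_upto:
  assumes "partials_upto (n + 2) a b c d G"
  shows "partials_upto n a b c d (helmholtz_family K G)"
  unfolding partials_upto_def
proof (intro allI impI ballI conjI)
  fix k l x y assume kl: "k + l < n" and xy: "x \<in> {a..b}" "y \<in> {c..d}"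
  have "((\<lambda>s. helmholtz_family K G k l s y) has_real_derivative
          G (Suc (k + 2)) l x y + G (Suc k) (l + 2) x y + K\<^sup>2 * G (Suc k) l x y) (at x within {a..b})"
    unfolding helmholtz_family_def
    by (intro DERIV_add DERIV_cmult partials_upto_x[OF assms _ xy]) (use kl in auto)
  thus "((\<lambda>s. helmholtz_family K G k l s y) has_real_derivative
          helmholtz_family K G (Suc k) l x y) (at x within {a..b})"
    by (simp add: helmholtz_family_def)
  have "((\<lambda>t. helmholtz_family K G k l x t) has_real_derivative
          G (k + 2) (Suc l) x y + G k (Suc (l + 2)) x y + K\<^sup>2 * G k (Suc l) x y) (at y within {c..d})"
    unfolding helmholtz_family_def
    by (intro DERIV_add DERIV_cmult partials_upto_y[OF assms _ xy]) (use kl in auto)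
  thus "((\<lambda>t. helmholtz_family K G k l x t) has_real_derivative
          helmholtz_family K G k (Suc l) x y) (at y within {c..d})"
    by (simp add: helmholtz_family_def)
qed

lemma helmholtz_family_bounded_upto:
  assumes "bounded_upto (n + 2) M a b c d G"
  shows "bounded_upto n ((2 + K\<^sup>2) * M) a b c d (helmholtz_family K G)"
  unfolding bounded_upto_def
proof (intro allI impI ballI)
  fix k l x y assume kl: "k + l \<le> n" and xy: "x \<in> {a..b}" "y \<in> {c..d}"
  have B: "\<bar>G i j x y\<bar> \<le> M" if "i + j \<le> n + 2" for i j
    using assms that xy unfolding bounded_upto_def by blast
  have "\<bar>K\<^sup>2 * G k l x y\<bar> \<le> K\<^sup>2 * M"
    unfolding abs_mult using B[of k l] kl by (simp add: mult_left_mono)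
  moreover have "\<bar>G (k + 2) l x y\<bar> \<le> M" "\<bar>G k (l + 2) x y\<bar> \<le> M"
    using B[of "k + 2" l] B[of k "l + 2"] kl by auto
  ultimately show "\<bar>helmholtz_family K G k l x y\<bar> \<le> (2 + K\<^sup>2) * M"
    unfolding helmholtz_family_def by (simp add: distrib_right)
qed

text \<open>
  Each second difference is replaced by its Taylor polynomial plus a power of \<open>h\<close> times a scaled
  remainder, which is bounded on the mesh. The identity above then leaves \<open>h\<^sup>6\<close> times a polynomial
  in bounded quantities.
\<close>

lemma truncation_error_sixth_order:
  fixes G :: "nat \<Rightarrow> nat \<Rightarrow> real \<Rightarrow> real \<Rightarrow> real" and K :: real
  assumes G: "partials_upto 8 a b c d G" "bounded_upto 8 M a b c d G"
  defines "F \<equiv> helmholtz_family K G"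
  obtains T where "\<And>h x y. mesh_square a b c d h x y \<Longrightarrow>
    \<bar>- alpha1 K h * (second_difference h (\<lambda>s. G 0 0 s y) x + second_difference h (G 0 0 x) y)
       - alpha2 K h * second_difference h (\<lambda>s. second_difference h (G 0 0 s) y) x
       - K\<^sup>2 * alpha3 K h * G 0 0 x y
     - (- beta1 K h * F 0 0 x y
        - beta2 K h * (second_difference h (\<lambda>s. F 0 0 s y) x + second_difference h (F 0 0 x) y)
        - beta3 K h * second_difference h (\<lambda>s. second_difference h (F 0 0 s) y) x
        - beta4 K h * (F 2 0 x y + F 0 2 x y)
        - beta5 K h * (second_difference h (\<lambda>s. F 2 0 s y) x + second_difference h (F 0 2 x) y))\<bar>
     \<le> T * h ^ 6"
proof -
  let ?S = "mesh_square a b c d"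
  define M' where "M' = (2 + K\<^sup>2) * M"
  have F: "partials_upto 6 a b c d F" "bounded_upto 6 M' a b c d F"
    unfolding F_def M'_def using G
    by (auto intro!: helmholtz_family_partials_upto helmholtz_family_bounded_upto)
  have S: "h > 0" "x - h \<in> {a..b}" "x + h \<in> {a..b}" "y - h \<in> {c..d}" "y + h \<in> {c..d}"
      "x \<in> {a..b}" "y \<in> {c..d}" if "?S h x y" for h x y
    using that by (auto simp: mesh_square_def)
  note hpos = S(1)
  define dx where "dx h x y = second_difference h (\<lambda>s. G 0 0 s y) x" for h x y
  define dy where "dy h x y = second_difference h (G 0 0 x) y" for h x y
  define dxy where "dxy h x y = second_difference h (\<lambda>s. second_difference h (G 0 0 s) y) x" for h x y
  define q1 where "q1 h x y = second_difference h (\<lambda>s. F 0 0 s y) x" for h x y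
  define q2 where "q2 h x y = second_difference h (F 0 0 x) y" for h x y
  define fxy where "fxy h x y = second_difference h (\<lambda>s. second_difference h (F 0 0 s) y) x" for h x y
  define fx where "fx h x y = second_difference h (\<lambda>s. F 2 0 s y) x" for h x y
  define fy where "fy h x y = second_difference h (F 0 2 x) y" for h x y
  define r1 where "r1 h x y = (dx h x y - (G 2 0 x y + h\<^sup>2 / 12 * G 4 0 x y + h ^ 4 / 360 * G 6 0 x y)) / h ^ 6" for h x y
  define r2 where "r2 h x y = (dy h x y - (G 0 2 x y + h\<^sup>2 / 12 * G 0 4 x y + h ^ 4 / 360 * G 0 6 x y)) / h ^ 6" for h x y
  define r3 where "r3 h x y = (dxy h x y - (G 2 2 x y + h\<^sup>2 / 12 * (G 4 2 x y + G 2 4 x y))) / h ^ 4" for h x y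
  define q3 where "q3 h x y = (fxy h x y - F 2 2 x y) / h\<^sup>2" for h x y
  define q4 where "q4 h x y = (fx h x y - F 4 0 x y) / h\<^sup>2" for h x y
  define q5 where "q5 h x y = (fy h x y - F 0 4 x y) / h\<^sup>2" for h x y
  have r1: "bounded_on_mesh ?S r1" unfolding r1_def [abs_def] dx_def
    by (rule bounded_on_mesh_quotient[OF _ hpos, where B = "2 * M"])
       (use second_difference_x_partials[OF G, of 0 0 3] S in
         \<open>simp add: lessThan_Suc eval_nat_numeral algebra_simps\<close>)
  have r2: "bounded_on_mesh ?S r2" unfolding r2_def [abs_def] dy_def
    by (rule bounded_on_mesh_quotient[OF _ hpos, where B = "2 * M"])
       (use second_difference_y_partials[OF G, of 0 0 3] S in
         \<open>simp add: lessThan_Suc eval_nat_numeral algebra_simps\<close>)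
  have r3: "bounded_on_mesh ?S r3" unfolding r3_def [abs_def] dxy_def
    by (rule bounded_on_mesh_quotient[OF mixed_second_difference_fourth_order[OF G] hpos]) (rule S; assumption)+
  have q1: "bounded_on_mesh ?S q1" unfolding q1_def [abs_def]
    by (rule bounded_on_meshI[where B = "2 * M'"])
       (use second_difference_x_partials[OF F, of 0 0 0] S in simp)
  have q2: "bounded_on_mesh ?S q2" unfolding q2_def [abs_def]
    by (rule bounded_on_meshI[where B = "2 * M'"])
       (use second_difference_y_partials[OF F, of 0 0 0] S in simp)
  have q3: "bounded_on_mesh ?S q3" unfolding q3_def [abs_def] fxy_def
    by (rule bounded_on_mesh_quotient[OF mixed_second_difference_second_order[OF F] hpos]) (rule S; assumption)+
  have q4: "bounded_on_mesh ?S q4" unfolding q4_def [abs_def] fx_def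
    by (rule bounded_on_mesh_quotient[OF _ hpos, where B = "2 * M'"])
       (use second_difference_x_partials[OF F, of 2 0 1] S in
         \<open>simp add: lessThan_Suc eval_nat_numeral algebra_simps\<close>)
  have q5: "bounded_on_mesh ?S q5" unfolding q5_def [abs_def] fy_def
    by (rule bounded_on_mesh_quotient[OF _ hpos, where B = "2 * M'"])
       (use second_difference_y_partials[OF F, of 0 2 1] S in
         \<open>simp add: lessThan_Suc eval_nat_numeral algebra_simps\<close>)
  have bG: "bounded_on_mesh ?S (\<lambda>h x y. G k l x y)" if "k + l \<le> 8" for k l
    by (rule bounded_on_meshI[where B = M]) (use G(2) S that in \<open>simp add: bounded_upto_def\<close>)
  have bF: "bounded_on_mesh ?S (\<lambda>h x y. F k l x y)" if "k + l \<le> 6" for k l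
    by (rule bounded_on_meshI[where B = M']) (use F(2) S that in \<open>simp add: bounded_upto_def\<close>)
  have bh: "bounded_on_mesh ?S (\<lambda>h x y. h)"
    by (rule bounded_on_meshI[where B = "b - a"]) (auto simp: mesh_square_def)
  define dx' where "dx' h x y = G 2 0 x y + h\<^sup>2 / 12 * G 4 0 x y + h ^ 4 / 360 * G 6 0 x y + h ^ 6 * r1 h x y" for h x y
  define dy' where "dy' h x y = G 0 2 x y + h\<^sup>2 / 12 * G 0 4 x y + h ^ 4 / 360 * G 0 6 x y + h ^ 6 * r2 h x y" for h x y
  define P where "P h x y = r1 h x y + r2 h x y + K ^ 6 / 20160 * (dx' h x y + dy' h x y)
         + 1 / 6 * (1 + K\<^sup>2 * h\<^sup>2 / 30 + K ^ 4 * h ^ 4 / 840) * r3 h x y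
         + K\<^sup>2 / 2160 * (G 4 2 x y + G 2 4 x y)
         + K ^ 4 / 5040 * (G 2 2 x y + h\<^sup>2 / 12 * (G 4 2 x y + G 2 4 x y))
         - K ^ 4 / 20160 * (q1 h x y + q2 h x y) - 1 / 90 * (1 + K\<^sup>2 * h\<^sup>2 / 112) * q3 h x y
         - K\<^sup>2 / 10080 * F 2 2 x y
         - 1 / 360 * (1 - K\<^sup>2 * h\<^sup>2 / 56) * (q4 h x y + q5 h x y)
         + K\<^sup>2 / 20160 * (F 4 0 x y + F 0 4 x y)" for h x y
  have "bounded_on_mesh ?S P"
    unfolding P_def [abs_def] dx'_def dy'_def
    by (intro bounded_on_mesh_intros r1 r2 r3 q1 q2 q3 q4 q5 bG bF bh) simp_all
  then obtain T where T: "\<And>h x y. ?S h x y \<Longrightarrow> \<bar>P h x y\<bar> \<le> T"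
    unfolding bounded_on_mesh_def by blast
  show ?thesis
  proof (rule that)
    fix h x y assume hxy: "?S h x y"
    have h: "h \<noteq> 0" using hpos[OF hxy] by simp
    have eq: "dx h x y = dx' h x y" "dy h x y = dy' h x y"
      "dxy h x y = G 2 2 x y + h\<^sup>2 / 12 * (G 4 2 x y + G 2 4 x y) + h ^ 4 * r3 h x y"
      "fxy h x y = F 2 2 x y + h\<^sup>2 * q3 h x y"
      "fx h x y = F 4 0 x y + h\<^sup>2 * q4 h x y" "fy h x y = F 0 4 x y + h\<^sup>2 * q5 h x y"
      using h by (simp_all add: dx'_def dy'_def r1_def r2_def r3_def q3_def q4_def q5_def)
    have F_eq: "F 0 0 x y = G 2 0 x y + G 0 2 x y + K\<^sup>2 * G 0 0 x y"
      "F 2 0 x y = G 4 0 x y + G 2 2 x y + K\<^sup>2 * G 2 0 x y"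
      "F 0 2 x y = G 2 2 x y + G 0 4 x y + K\<^sup>2 * G 0 2 x y"
      "F 4 0 x y = G 6 0 x y + G 4 2 x y + K\<^sup>2 * G 4 0 x y"
      "F 2 2 x y = G 4 2 x y + G 2 4 x y + K\<^sup>2 * G 2 2 x y"
      "F 0 4 x y = G 2 4 x y + G 0 6 x y + K\<^sup>2 * G 0 4 x y"
      by (simp_all add: F_def helmholtz_family_def eval_nat_numeral)
    let ?A = "- alpha1 K h * (dx h x y + dy h x y) - alpha2 K h * dxy h x y - K\<^sup>2 * alpha3 K h * G 0 0 x y
     - (- beta1 K h * F 0 0 x y - beta2 K h * (q1 h x y + q2 h x y) - beta3 K h * fxy h x y
        - beta4 K h * (F 2 0 x y + F 0 2 x y) - beta5 K h * (fx h x y + fy h x y))"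
    have "?A = - (h ^ 6) * P h x y"
      unfolding eq P_def dx'_def dy'_def F_eq by (rule truncation_identity)
    hence "\<bar>?A\<bar> = h ^ 6 * \<bar>P h x y\<bar>" by (simp add: abs_mult)
    also have "\<dots> \<le> h ^ 6 * T" by (rule mult_left_mono[OF T[OF hxy]]) simp
    finally show "\<bar>- alpha1 K h * (second_difference h (\<lambda>s. G 0 0 s y) x + second_difference h (G 0 0 x) y)
       - alpha2 K h * second_difference h (\<lambda>s. second_difference h (G 0 0 s) y) x
       - K\<^sup>2 * alpha3 K h * G 0 0 x y
     - (- beta1 K h * F 0 0 x y
        - beta2 K h * (second_difference h (\<lambda>s. F 0 0 s y) x + second_difference h (F 0 0 x) y)
        - beta3 K h * second_difference h (\<lambda>s. second_difference h (F 0 0 s) y) x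
        - beta4 K h * (F 2 0 x y + F 0 2 x y)
        - beta5 K h * (second_difference h (\<lambda>s. F 2 0 s y) x + second_difference h (F 0 2 x) y))\<bar>
     \<le> T * h ^ 6"
      by (simp add: dx_def dy_def dxy_def q1_def q2_def fxy_def fx_def fy_def mult.commute)
  qed
qed


section \<open>Discrete sine expansion and stability\<close>

lemma expansion_inversion:
  fixes B :: "'p \<Rightarrow> 'p \<Rightarrow> real"
  assumes "finite P" and "q \<in> P"
    and orth: "\<And>q r. q \<in> P \<Longrightarrow> r \<in> P \<Longrightarrow> (\<Sum>p\<in>P. B p q * B p r) = (if q = r then \<kappa> else 0)"
  shows "(\<Sum>p\<in>P. (\<Sum>r\<in>P. B p r * \<phi> r) * B p q) = \<kappa> * \<phi> q"
proof -
  have "(\<Sum>p\<in>P. (\<Sum>r\<in>P. B p r * \<phi> r) * B p q) = (\<Sum>r\<in>P. \<phi> r * (\<Sum>p\<in>P. B p r * B p q))"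
    unfolding sum_distrib_right sum_distrib_left by (subst sum.swap) (simp only: mult_ac)
  also have "\<dots> = (\<Sum>r\<in>P. if r = q then \<kappa> * \<phi> r else 0)"
    by (intro sum.cong refl) (simp add: orth assms(2))
  also have "\<dots> = \<kappa> * \<phi> q"
    using assms(1,2) by simp
  finally show ?thesis .
qed

lemma expansion_Parseval:
  fixes B :: "'p \<Rightarrow> 'p \<Rightarrow> real"
  assumes "finite P"
    and orth: "\<And>q r. q \<in> P \<Longrightarrow> r \<in> P \<Longrightarrow> (\<Sum>p\<in>P. B p q * B p r) = (if q = r then \<kappa> else 0)"
  shows "(\<Sum>p\<in>P. (\<Sum>r\<in>P. B p r * \<phi> r)\<^sup>2) = \<kappa> * (\<Sum>r\<in>P. (\<phi> r)\<^sup>2)"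
proof -
  have "(\<Sum>p\<in>P. (\<Sum>r\<in>P. B p r * \<phi> r)\<^sup>2)
      = (\<Sum>p\<in>P. \<Sum>q\<in>P. \<phi> q * ((\<Sum>r\<in>P. B p r * \<phi> r) * B p q))"
    by (simp add: power2_eq_square sum_distrib_left mult_ac)
  also have "\<dots> = (\<Sum>q\<in>P. \<phi> q * (\<Sum>p\<in>P. (\<Sum>r\<in>P. B p r * \<phi> r) * B p q))"
    by (subst sum.swap) (simp add: sum_distrib_left)
  also have "\<dots> = (\<Sum>q\<in>P. \<phi> q * (\<kappa> * \<phi> q))"
    by (intro sum.cong refl arg_cong2[where f="(*)"] expansion_inversion) (use assms in auto)
  finally show ?thesis
    by (simp add: power2_eq_square sum_distrib_left mult_ac)
qed

text \<open>
  The kernel \<open>B\<close> is an orthogonal eigenbasis with eigenvalues \<open>\<mu>\<close>, so the coefficients of \<open>e\<close> are those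
  of \<open>\<tau>\<close> divided by \<open>\<mu>\<close>. An estimate in the quadratic norm alone would lose a power of the mesh
  size when passing to the maximum. Summing the expansion absolutely instead and applying
  Cauchy-Schwarz avoids the loss: Parseval controls the coefficients of \<open>\<tau>\<close>, and the rest is the
  sum of the inverse squares of the eigenvalues. The hypothesis on the cardinality is modelled on the
  sine basis, where \<open>\<kappa> = (N / 2)\<^sup>2\<close> and there are \<open>(N - 1)\<^sup>2\<close> vectors.
\<close>

lemma sup_bound_by_inverse_square_eigenvalues:
  fixes B :: "'p \<Rightarrow> 'p \<Rightarrow> real"
  assumes "finite P" and "q \<in> P" and "\<kappa> > 0"
    and orth: "\<And>q r. q \<in> P \<Longrightarrow> r \<in> P \<Longrightarrow> (\<Sum>p\<in>P. B p q * B p r) = (if q = r then \<kappa> else 0)"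
    and B1: "\<And>p. p \<in> P \<Longrightarrow> \<bar>B p q\<bar> \<le> 1"
    and lam: "\<And>p. p \<in> P \<Longrightarrow> \<mu> p \<noteq> 0"
    and eig: "\<And>p. p \<in> P \<Longrightarrow> (\<Sum>r\<in>P. B p r * \<tau> r) = \<mu> p * (\<Sum>r\<in>P. B p r * e r)"
    and T: "\<And>r. r \<in> P \<Longrightarrow> \<bar>\<tau> r\<bar> \<le> T"
    and A: "(\<Sum>p\<in>P. 1 / (\<mu> p)\<^sup>2) \<le> A\<^sup>2" and "A \<ge> 0"
    and card: "real (card P) \<le> 4 * \<kappa>"
  shows "\<bar>e q\<bar> \<le> 2 * T * A"
proof -
  define eh where "eh p = (\<Sum>r\<in>P. B p r * e r)" for p
  define th where "th p = (\<Sum>r\<in>P. B p r * \<tau> r)" for p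
  have T0: "T \<ge> 0" using T[OF \<open>q \<in> P\<close>] by linarith
  have "\<kappa> * \<bar>e q\<bar> = \<bar>\<Sum>p\<in>P. eh p * B p q\<bar>"
    unfolding eh_def using \<open>\<kappa> > 0\<close>
    by (subst expansion_inversion[OF assms(1,2) orth]) (auto simp: abs_mult)
  also have "\<dots> \<le> (\<Sum>p\<in>P. \<bar>eh p\<bar> * 1)"
    by (intro order.trans[OF sum_abs] sum_mono) (auto simp: abs_mult intro!: mult_left_le B1)
  also have "\<dots> = (\<Sum>p\<in>P. \<bar>th p\<bar> * \<bar>1 / \<mu> p\<bar>)"
    by (intro sum.cong refl) (simp add: eh_def th_def abs_mult lam eig)
  also have "\<dots> \<le> L2_set th P * L2_set (\<lambda>p. 1 / \<mu> p) P"
    by (rule L2_set_mult_ineq)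
  also have "\<dots> \<le> (2 * \<kappa> * T) * A"
  proof (intro mult_mono)
    have "(\<Sum>p\<in>P. (th p)\<^sup>2) = \<kappa> * (\<Sum>r\<in>P. (\<tau> r)\<^sup>2)"
      unfolding th_def by (rule expansion_Parseval[OF assms(1) orth])
    also have "\<dots> \<le> \<kappa> * (\<Sum>r\<in>P. T\<^sup>2)"
      using \<open>\<kappa> > 0\<close> T T0 by (intro mult_left_mono sum_mono abs_le_square_iff[THEN iffD1]) auto
    also have "\<dots> \<le> \<kappa> * (4 * \<kappa> * T\<^sup>2)"
      using \<open>\<kappa> > 0\<close> card by (intro mult_left_mono) (auto intro!: mult_right_mono)
    also have "\<dots> = (2 * \<kappa> * T)\<^sup>2" by (simp add: power2_eq_square)
    finally show "L2_set th P \<le> 2 * \<kappa> * T"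
      unfolding L2_set_def using \<open>\<kappa> > 0\<close> T0 by (intro real_le_lsqrt) (auto intro: sum_nonneg)
    show "L2_set (\<lambda>p. 1 / \<mu> p) P \<le> A"
      unfolding L2_set_def using A \<open>A \<ge> 0\<close>
      by (intro real_le_lsqrt) (auto intro: sum_nonneg simp: power_divide)
  qed (use \<open>\<kappa> > 0\<close> T0 in auto)
  also have "(2 * \<kappa> * T) * A = \<kappa> * (2 * T * A)" by (simp only: mult_ac)
  finally have "\<kappa> * \<bar>e q\<bar> \<le> \<kappa> * (2 * T * A)" .
  thus ?thesis using \<open>\<kappa> > 0\<close> by (rule mult_left_le_imp_le)
qed

definition dsin :: "nat \<Rightarrow> nat \<Rightarrow> nat \<Rightarrow> real" where
  "dsin N m i = sin (real m * real i * pi / real N)"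

lemma dsin_commute: "dsin N m i = dsin N i m"
  by (simp add: dsin_def mult_ac)

lemma dsin_boundary [simp]: "dsin N m 0 = 0" "dsin N m N = 0"
  by (auto simp: dsin_def)

lemma dsin_second_difference:
  assumes "i \<ge> 1"
  shows "dsin N m (i - 1) - 2 * dsin N m i + dsin N m (i + 1)
       = - (4 * (sin (real m * pi / (2 * real N)))\<^sup>2) * dsin N m i"
proof -
  define \<theta> where "\<theta> = real m * pi / real N"
  have "dsin N m (i - 1) = sin (real i * \<theta> - \<theta>)" "dsin N m (i + 1) = sin (real i * \<theta> + \<theta>)"
      "dsin N m i = sin (real i * \<theta>)"
    using assms by (simp_all add: dsin_def \<theta>_def of_nat_diff field_simps diff_divide_distrib add_divide_distrib)
  moreover have "cos \<theta> = 1 - 2 * (sin (real m * pi / (2 * real N)))\<^sup>2"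
    using cos_double_sin[of "\<theta> / 2"] by (simp add: \<theta>_def mult.commute)
  ultimately show ?thesis
    by (simp add: sin_add sin_diff algebra_simps)
qed

text \<open>
  The difference of the summands on both sides telescopes, and the boundary values are zero.
\<close>

lemma discrete_Green:
  fixes \<phi> \<psi> :: "nat \<Rightarrow> real"
  assumes "\<phi> 0 = 0" "\<phi> N = 0" "\<psi> 0 = 0" "\<psi> N = 0"
  shows "(\<Sum>i=1..N-1. (\<phi> (i - 1) - 2 * \<phi> i + \<phi> (i + 1)) * \<psi> i)
       = (\<Sum>i=1..N-1. \<phi> i * (\<psi> (i - 1) - 2 * \<psi> i + \<psi> (i + 1)))"
proof -
  define w where "w i = \<phi> (i + 1) * \<psi> i - \<phi> i * \<psi> (i + 1)" for i
  have tel: "(\<Sum>i=1..n. w i - w (i - 1)) = w n - w 0" for n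
    by (induction n) auto
  have "w (N - 1) = 0" using assms by (cases N) (auto simp: w_def)
  hence "(\<Sum>i=1..N-1. w i - w (i - 1)) = 0"
    unfolding tel using assms by (simp add: w_def)
  moreover have "(\<Sum>i=1..N-1. w i - w (i - 1))
      = (\<Sum>i=1..N-1. (\<phi> (i - 1) - 2 * \<phi> i + \<phi> (i + 1)) * \<psi> i - \<phi> i * (\<psi> (i - 1) - 2 * \<psi> i + \<psi> (i + 1)))"
    by (intro sum.cong refl) (simp add: w_def algebra_simps)
  ultimately show ?thesis by (simp add: sum_subtractf)
qed

lemma dsin_summation_by_parts:
  assumes "\<phi> 0 = 0" "\<phi> N = 0"
  shows "(\<Sum>i=1..N-1. dsin N m i * (\<phi> (i - 1) - 2 * \<phi> i + \<phi> (i + 1)))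
       = - (4 * (sin (real m * pi / (2 * real N)))\<^sup>2) * (\<Sum>i=1..N-1. dsin N m i * \<phi> i)"
proof -
  have "(\<Sum>i=1..N-1. dsin N m i * (\<phi> (i - 1) - 2 * \<phi> i + \<phi> (i + 1)))
      = (\<Sum>i=1..N-1. \<phi> i * (dsin N m (i - 1) - 2 * dsin N m i + dsin N m (i + 1)))"
    using discrete_Green[of \<phi> N "dsin N m"] assms by (simp add: mult_ac)
  also have "\<dots> = (\<Sum>i=1..N-1. - (4 * (sin (real m * pi / (2 * real N)))\<^sup>2) * (dsin N m i * \<phi> i))"
    by (intro sum.cong refl) (subst dsin_second_difference; simp)
  finally show ?thesis by (simp only: sum_distrib_left)
qed

text \<open>
  Half-angle formula, then the sum of \<open>cos (2 m x)\<close> over a full period is 0; multiplied by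
  \<open>2 sin x\<close> it telescopes.
\<close>

lemma dsin_norm:
  assumes "i \<in> {1..N-1}"
  shows "(\<Sum>m=1..N-1. (dsin N m i)\<^sup>2) = real N / 2"
proof -
  define x where "x = real i * pi / real N"
  have N: "N > 0" and iN: "0 < i" "i < N" using assms by auto
  have tel: "2 * sin x * (\<Sum>m<n. cos (2 * real m * x)) = sin ((2 * real n - 1) * x) + sin x" for n
  proof (induction n)
    case (Suc n)
    have "2 * sin x * cos (2 * real n * x) = sin (2 * real n * x + x) - sin (2 * real n * x - x)"
      by (simp add: sin_add sin_diff)
    also have "2 * real n * x + x = (2 * real (Suc n) - 1) * x" by (simp add: algebra_simps)
    also have "2 * real n * x - x = (2 * real n - 1) * x" by (simp add: algebra_simps)
    finally show ?case using Suc by (simp add: distrib_left)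
  qed simp
  have "(2 * real N - 1) * x = 2 * pi * real i - x"
    using N by (simp add: x_def field_simps)
  hence "sin ((2 * real N - 1) * x) = - sin x"
    using sin_int_2pin[of "int i"] cos_int_2pin[of "int i"] by (simp add: sin_diff)
  moreover have "sin x > 0"
    by (rule sin_gt_zero) (use iN in \<open>auto simp: x_def field_simps\<close>)
  ultimately have cos0: "(\<Sum>m<N. cos (2 * real m * x)) = 0"
    using tel[of N] by auto
  have "(\<Sum>m=1..N-1. (dsin N m i)\<^sup>2) = (\<Sum>m<N. (dsin N m i)\<^sup>2)"
    by (rule sum.mono_neutral_left) (use N in \<open>auto simp: dsin_def not_le\<close>)
  also have "\<dots> = (\<Sum>m<N. (1 - cos (2 * real m * x)) / 2)"
  proof (intro sum.cong refl)
    fix m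
    show "(dsin N m i)\<^sup>2 = (1 - cos (2 * real m * x)) / 2"
      using cos_double_sin[of "real m * x"] by (simp add: dsin_def x_def mult_ac)
  qed
  also have "\<dots> = (real N - (\<Sum>m<N. cos (2 * real m * x))) / 2"
    by (simp add: sum_subtractf sum_divide_distrib[symmetric])
  finally show ?thesis using cos0 by simp
qed

text \<open>
  For different indices these are eigenvectors of a symmetric operator with different
  eigenvalues, because \<open>sin\<close> is strictly increasing on the first quarter period.
\<close>

lemma dsin_orthogonal:
  assumes "i \<in> {1..N-1}" "j \<in> {1..N-1}"
  shows "(\<Sum>m=1..N-1. dsin N m i * dsin N m j) = (if i = j then real N / 2 else 0)"
proof (cases "i = j")
  case True
  thus ?thesis using dsin_norm[OF assms(1)] by (simp add: power2_eq_square)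
next
  case False
  define s where "s k = sin (real k * pi / (2 * real N))" for k
  have s_mono: "s k < s l" if "k < l" "l < N" for k l
    unfolding s_def using that by (intro sin_monotone_2pi) (auto simp: field_simps intro: order.trans[of _ 0])
  have s_pos: "s k \<ge> 0" if "k < N" for k
    unfolding s_def using that by (intro sin_ge_zero) (auto simp: field_simps)
  have "s i \<noteq> s j"
    using False assms s_mono[of i j] s_mono[of j i] by (fastforce simp: neq_iff)
  hence ne: "(s i)\<^sup>2 \<noteq> (s j)\<^sup>2"
    using assms s_pos[of i] s_pos[of j] by (subst power2_eq_iff_nonneg) auto
  let ?S = "\<Sum>m=1..N-1. dsin N i m * dsin N j m"
  have "- (4 * (s i)\<^sup>2) * ?S = - (4 * (s j)\<^sup>2) * ?S"
    using dsin_summation_by_parts[of "dsin N j" N i] dsin_summation_by_parts[of "dsin N i" N j]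
      discrete_Green[of "dsin N i" N "dsin N j"]
    by (auto simp: s_def mult_ac)
  hence "?S = 0" using ne by auto
  thus ?thesis using False by (simp add: dsin_commute[of N _ i] dsin_commute[of N _ j])
qed


definition dsin2 :: "nat \<Rightarrow> nat \<times> nat \<Rightarrow> nat \<times> nat \<Rightarrow> real" where
  "dsin2 N p q = dsin N (fst p) (fst q) * dsin N (snd p) (snd q)"

lemma dsin2_le_1: "\<bar>dsin2 N p q\<bar> \<le> 1"
  unfolding dsin2_def dsin_def abs_mult by (intro mult_le_one) auto

lemma dsin2_orthogonal:
  assumes "q \<in> {1..N-1} \<times> {1..N-1}" "r \<in> {1..N-1} \<times> {1..N-1}"
  shows "(\<Sum>p\<in>{1..N-1} \<times> {1..N-1}. dsin2 N p q * dsin2 N p r)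
       = (if q = r then (real N / 2)\<^sup>2 else 0)"
proof -
  obtain i j k l where qr: "q = (i, j)" "r = (k, l)" by fastforce
  have "(\<Sum>p\<in>{1..N-1} \<times> {1..N-1}. dsin2 N p q * dsin2 N p r)
      = (\<Sum>m=1..N-1. \<Sum>n=1..N-1. (dsin N m i * dsin N m k) * (dsin N n j * dsin N n l))"
    by (simp add: sum.cartesian_product case_prod_unfold dsin2_def qr mult_ac)
  also have "\<dots> = (\<Sum>m=1..N-1. dsin N m i * dsin N m k) * (\<Sum>n=1..N-1. dsin N n j * dsin N n l)"
    by (rule sum_product [symmetric])
  also have "\<dots> = (if q = r then (real N / 2)\<^sup>2 else 0)"
    using dsin_orthogonal[of i N k] dsin_orthogonal[of j N l] assms
    by (auto simp: qr power2_eq_square)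
  finally show ?thesis .
qed

definition sine_coeff :: "nat \<Rightarrow> nat \<Rightarrow> nat \<Rightarrow> (nat \<Rightarrow> nat \<Rightarrow> real) \<Rightarrow> real" where
  "sine_coeff N m n \<phi> = (\<Sum>i=1..N-1. \<Sum>j=1..N-1. dsin N m i * dsin N n j * \<phi> i j)"

text \<open>
  The eigenvalue of \<open>-\<delta>\<^sub>x\<^sup>2\<close> on the discrete sine with frequency \<open>m\<close>.
\<close>

definition delta_symbol :: "nat \<Rightarrow> real \<Rightarrow> nat \<Rightarrow> real" where
  "delta_symbol N h m = 4 * (sin (real m * pi / (2 * real N)))\<^sup>2 / h\<^sup>2"

lemma sine_coeff_dsin2:
  "sine_coeff N m n \<phi> = (\<Sum>r\<in>{1..N-1} \<times> {1..N-1}. dsin2 N (m, n) r * \<phi> (fst r) (snd r))"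
  by (simp add: sine_coeff_def dsin2_def sum.cartesian_product case_prod_unfold)

lemma sine_coeff_delta_x2:
  assumes "\<And>j. j \<in> {1..N-1} \<Longrightarrow> \<phi> 0 j = 0 \<and> \<phi> N j = 0"
  shows "sine_coeff N m n (delta_x2 h \<phi>) = - delta_symbol N h m * sine_coeff N m n \<phi>"
proof -
  have "sine_coeff N m n (delta_x2 h \<phi>) = (\<Sum>j=1..N-1. dsin N n j *
      ((\<Sum>i=1..N-1. dsin N m i * (\<phi> (i - 1) j - 2 * \<phi> i j + \<phi> (i + 1) j)) / h\<^sup>2))"
    unfolding sine_coeff_def delta_x2_def
    by (subst sum.swap) (simp add: sum_distrib_left sum_divide_distrib mult_ac)
  also have "\<dots> = (\<Sum>j=1..N-1. dsin N n j *
      (- delta_symbol N h m * (\<Sum>i=1..N-1. dsin N m i * \<phi> i j)))"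
    by (intro sum.cong refl arg_cong2[where f="(*)"], subst dsin_summation_by_parts)
       (use assms in \<open>auto simp: delta_symbol_def\<close>)
  also have "\<dots> = - delta_symbol N h m * sine_coeff N m n \<phi>"
    unfolding sine_coeff_def
    by (subst sum.swap[of _ "{1..N-1}" "{1..N-1}"]) (simp add: sum_distrib_left mult_ac sum_negf)
  finally show ?thesis .
qed

lemma sine_coeff_delta_y2:
  assumes "\<And>i. i \<in> {1..N-1} \<Longrightarrow> \<phi> i 0 = 0 \<and> \<phi> i N = 0"
  shows "sine_coeff N m n (delta_y2 h \<phi>) = - delta_symbol N h n * sine_coeff N m n \<phi>"
proof -
  have swap: "sine_coeff N m n \<psi> = sine_coeff N n m (\<lambda>i j. \<psi> j i)" for \<psi>
    unfolding sine_coeff_def by (subst sum.swap) (simp add: mult_ac)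
  have "sine_coeff N m n (delta_y2 h \<phi>) = sine_coeff N n m (delta_x2 h (\<lambda>i j. \<phi> j i))"
    by (subst swap) (simp add: delta_x2_def[abs_def] delta_y2_def)
  also have "\<dots> = - delta_symbol N h n * sine_coeff N n m (\<lambda>i j. \<phi> j i)"
    by (rule sine_coeff_delta_x2) (use assms in auto)
  finally show ?thesis by (simp add: swap[of \<phi>])
qed

text \<open>
  The eigenvalue of the difference operator on the product of two discrete sines.
\<close>

definition scheme_symbol :: "real \<Rightarrow> nat \<Rightarrow> real \<Rightarrow> nat \<Rightarrow> nat \<Rightarrow> real" where
  "scheme_symbol K N h m n =
     alpha1 K h * (delta_symbol N h m + delta_symbol N h n)
     - alpha2 K h * delta_symbol N h m * delta_symbol N h n - K\<^sup>2 * alpha3 K h"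

definition zero_boundary :: "nat \<Rightarrow> (nat \<Rightarrow> nat \<Rightarrow> real) \<Rightarrow> bool" where
  "zero_boundary N e \<longleftrightarrow>
     (\<forall>i\<in>{0..N}. \<forall>j\<in>{0..N}. i = 0 \<or> i = N \<or> j = 0 \<or> j = N \<longrightarrow> e i j = 0)"

lemma zero_boundaryD:
  assumes "zero_boundary N e" and "k \<in> {0..N}"
  shows "e 0 k = 0 \<and> e N k = 0 \<and> e k 0 = 0 \<and> e k N = 0"
proof -
  have "e i j = 0" if "i \<in> {0..N}" "j \<in> {0..N}" "i = 0 \<or> i = N \<or> j = 0 \<or> j = N" for i j
    using assms(1) that unfolding zero_boundary_def by blast
  thus ?thesis using assms(2) by simp
qed

text \<open>
  Summation by parts moves each second difference onto the sine vector. This needs zero boundary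
  values of \<open>e\<close>, and also of \<open>\<delta>\<^sub>y\<^sup>2 e\<close> on the two vertical sides, which follow from those of \<open>e\<close>.
\<close>

lemma sine_coeff_scheme_op:
  assumes "zero_boundary N e"
  shows "sine_coeff N m n (scheme_op K h e) = scheme_symbol K N h m n * sine_coeff N m n e"
proof -
  have lin: "sine_coeff N m n (scheme_op K h e)
     = - alpha1 K h * (sine_coeff N m n (delta_x2 h e) + sine_coeff N m n (delta_y2 h e))
       - alpha2 K h * sine_coeff N m n (delta_x2 h (delta_y2 h e))
       - K\<^sup>2 * alpha3 K h * sine_coeff N m n e"
    unfolding sine_coeff_def scheme_op_def
    by (simp add: sum_distrib_left sum.distrib sum_subtractf algebra_simps sum_negf)
  have "sine_coeff N m n (delta_x2 h e) = - delta_symbol N h m * sine_coeff N m n e"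
    by (rule sine_coeff_delta_x2) (use zero_boundaryD[OF assms] in auto)
  moreover have y: "sine_coeff N m n (delta_y2 h e) = - delta_symbol N h n * sine_coeff N m n e"
    by (rule sine_coeff_delta_y2) (use zero_boundaryD[OF assms] in auto)
  moreover have "sine_coeff N m n (delta_x2 h (delta_y2 h e))
      = - delta_symbol N h m * sine_coeff N m n (delta_y2 h e)"
    by (rule sine_coeff_delta_x2) (use zero_boundaryD[OF assms] in \<open>auto simp: delta_y2_def\<close>)
  ultimately show ?thesis
    unfolding lin scheme_symbol_def by (simp add: algebra_simps)
qed

lemma sum_inverse_squares_le: "(\<Sum>m=1..n. 1 / (real m)\<^sup>2) \<le> 2"
proof -
  have "(\<Sum>m=1..Suc n. 1 / (real m)\<^sup>2) \<le> 2 - 1 / real (Suc n)" for n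
  proof (induction n)
    case (Suc n)
    have "1 / (real (Suc (Suc n)))\<^sup>2 \<le> 1 / real (Suc n) - 1 / real (Suc (Suc n))"
      by (simp add: divide_simps power2_eq_square)
    thus ?case using Suc by simp
  qed simp
  from this[of "n - 1"] show ?thesis
    by (cases n) (auto intro: order.trans)
qed

text \<open>
  As \<open>\<kappa> m n\<close> bounds the eigenvalues from below, the sum of their inverse squares is at most the
  square of the convergent series of \<open>1 / m\<^sup>2\<close>, divided by \<open>\<kappa>\<^sup>2\<close>. This bound is independent of \<open>N\<close>.
\<close>

lemma scheme_stability:
  assumes "zero_boundary N e" and "\<kappa> > 0"
    and symbol: "\<And>m n. m \<in> {1..N-1} \<Longrightarrow> n \<in> {1..N-1} \<Longrightarrow>
            \<kappa> * real m * real n \<le> \<bar>scheme_symbol K N h m n\<bar>"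
    and T: "\<And>i j. i \<in> {1..N-1} \<Longrightarrow> j \<in> {1..N-1} \<Longrightarrow> \<bar>scheme_op K h e i j\<bar> \<le> T"
    and ij: "i \<in> {1..N-1}" "j \<in> {1..N-1}"
  shows "\<bar>e i j\<bar> \<le> 4 * T / \<kappa>"
proof -
  let ?P = "{1..N-1} \<times> {1..N-1}"
  have N: "N > 0" using ij by auto
  have "\<bar>(\<lambda>r. e (fst r) (snd r)) (i, j)\<bar> \<le> 2 * T * (2 / \<kappa>)"
  proof (rule sup_bound_by_inverse_square_eigenvalues
      [where P = ?P and B = "dsin2 N" and \<kappa> = "(real N / 2)\<^sup>2"
         and \<mu> = "\<lambda>p. scheme_symbol K N h (fst p) (snd p)"
         and \<tau> = "\<lambda>r. scheme_op K h e (fst r) (snd r)"])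
    show "(\<Sum>p\<in>?P. dsin2 N p q * dsin2 N p r) = (if q = r then (real N / 2)\<^sup>2 else 0)"
      if "q \<in> ?P" "r \<in> ?P" for q r
      using that by (rule dsin2_orthogonal)
    show "scheme_symbol K N h (fst p) (snd p) \<noteq> 0" if "p \<in> ?P" for p
    proof -
      have "0 < \<kappa> * real (fst p) * real (snd p)" using that \<open>\<kappa> > 0\<close> by auto
      thus ?thesis using symbol[of "fst p" "snd p"] that by (auto simp: mem_Times_iff)
    qed
    show "(\<Sum>r\<in>?P. dsin2 N p r * scheme_op K h e (fst r) (snd r))
        = scheme_symbol K N h (fst p) (snd p) * (\<Sum>r\<in>?P. dsin2 N p r * e (fst r) (snd r))" for p
      using sine_coeff_scheme_op[OF assms(1), of "fst p" "snd p" K h]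
      by (simp add: sine_coeff_dsin2)
    have "(\<Sum>p\<in>?P. 1 / (scheme_symbol K N h (fst p) (snd p))\<^sup>2)
        \<le> (\<Sum>p\<in>?P. (1 / \<kappa>\<^sup>2) * ((1 / (real (fst p))\<^sup>2) * (1 / (real (snd p))\<^sup>2)))"
    proof (rule sum_mono)
      fix p assume p: "p \<in> ?P"
      hence pos: "0 < \<kappa> * real (fst p) * real (snd p)" using \<open>\<kappa> > 0\<close> by auto
      have "(\<kappa> * real (fst p) * real (snd p))\<^sup>2 \<le> (scheme_symbol K N h (fst p) (snd p))\<^sup>2"
        using symbol[of "fst p" "snd p"] p pos
        by (intro abs_le_square_iff[THEN iffD1]) (auto simp: mem_Times_iff)
      hence "1 / (scheme_symbol K N h (fst p) (snd p))\<^sup>2 \<le> 1 / (\<kappa> * real (fst p) * real (snd p))\<^sup>2"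
        by (intro frac_le zero_less_power[OF pos]) auto
      thus "1 / (scheme_symbol K N h (fst p) (snd p))\<^sup>2
          \<le> (1 / \<kappa>\<^sup>2) * ((1 / (real (fst p))\<^sup>2) * (1 / (real (snd p))\<^sup>2))"
        by (simp add: power_mult_distrib)
    qed
    also have "\<dots> = (1 / \<kappa>\<^sup>2) * ((\<Sum>m=1..N-1. 1 / (real m)\<^sup>2) * (\<Sum>m=1..N-1. 1 / (real m)\<^sup>2))"
      unfolding sum_product sum.cartesian_product case_prod_unfold
      by (simp only: sum_distrib_left)
    also have "\<dots> \<le> (1 / \<kappa>\<^sup>2) * (2 * 2)"
      by (intro mult_left_mono mult_mono sum_inverse_squares_le) (auto intro: sum_nonneg)
    also have "\<dots> = (2 / \<kappa>)\<^sup>2" by (simp add: power_divide)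
    finally show "(\<Sum>p\<in>?P. 1 / (scheme_symbol K N h (fst p) (snd p))\<^sup>2) \<le> (2 / \<kappa>)\<^sup>2" .
    have "real (card ?P) = (real N - 1)\<^sup>2"
      using N by (simp add: card_cartesian_product power2_eq_square of_nat_diff)
    also have "\<dots> \<le> (real N)\<^sup>2" using N by (intro power_mono) auto
    finally show "real (card ?P) \<le> 4 * (real N / 2)\<^sup>2" by (simp add: power_divide)
  qed (use ij N \<open>\<kappa> > 0\<close> in \<open>auto simp del: One_nat_def intro!: T dsin2_le_1\<close>)
  thus ?thesis by simp
qed


section \<open>Lower bounds for the eigenvalues of the scheme\<close>

lemma sin_ge_third:
  assumes "0 \<le> x" "x \<le> pi / 2"
  shows "x / 3 \<le> sin x"
proof -
  have "\<bar>sin x - (\<Sum>m<3. sin_coeff m * x ^ m)\<bar> \<le> inverse (fact 3) * \<bar>x\<bar> ^ 3"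
    by (rule Maclaurin_sin_bound)
  moreover have "(\<Sum>m<3. sin_coeff m * x ^ m) = x"
    by (simp add: sin_coeff_def lessThan_Suc eval_nat_numeral)
  ultimately have "\<bar>sin x - x\<bar> \<le> x ^ 3 / 6"
    using assms by (simp add: fact_numeral)
  hence "x - x ^ 3 / 6 \<le> sin x" by linarith
  moreover have "x\<^sup>2 \<le> 2\<^sup>2"
    using assms pi_half_less_two by (intro power_mono) auto
  hence "x * x\<^sup>2 \<le> x * 4"
    using assms by (intro mult_left_mono) auto
  ultimately show ?thesis by (simp add: power2_eq_square power3_eq_cube)
qed

text \<open>
  The argument of the sine is at most \<open>\<pi> / 2\<close>, so the sine is comparable to it; the discrete
  eigenvalues thus grow like the continuous ones over the whole frequency range.
\<close>

lemma delta_symbol_lower: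
  assumes "real N * h = L" "h > 0" "m \<le> N" "N > 0"
  shows "4 / 9 * (real m)\<^sup>2 / L\<^sup>2 \<le> delta_symbol N h m"
proof -
  let ?x = "real m * pi / (2 * real N)"
  have "real m / (3 * real N) \<le> ?x / 3"
    using mult_left_mono[OF pi_ge_two, of "real m"] assms by (simp add: field_simps)
  also have "\<dots> \<le> sin ?x"
    using assms by (intro sin_ge_third) (auto simp: field_simps)
  finally have "(real m / (3 * real N))\<^sup>2 \<le> (sin ?x)\<^sup>2"
    by (intro power_mono) auto
  hence "4 * (real m / (3 * real N))\<^sup>2 / h\<^sup>2 \<le> delta_symbol N h m"
    unfolding delta_symbol_def by (intro divide_right_mono mult_left_mono) auto
  moreover have "4 * (real m / (3 * real N))\<^sup>2 / h\<^sup>2 = 4 / 9 * (real m)\<^sup>2 / L\<^sup>2"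
    unfolding assms(1)[symmetric] by (simp add: power_mult_distrib power_divide)
  ultimately show ?thesis by simp
qed

lemma delta_symbol_upper: "delta_symbol N h m * h\<^sup>2 \<le> 4"
  by (cases "h = 0") (auto simp: delta_symbol_def abs_square_le_1)

lemma delta_symbol_nonneg: "delta_symbol N h m \<ge> 0"
  by (simp add: delta_symbol_def)

text \<open>
  The mixed term has the wrong sign, but its coefficient is about \<open>h\<^sup>2 / 6\<close> and the symbols are at
  most \<open>4 / h\<^sup>2\<close>. For \<open>K h \<le> 1\<close> it therefore takes away at most half of the Laplacian part.
\<close>

lemma scheme_symbol_lower:
  assumes "\<bar>K * h\<bar> \<le> 1"
  shows "(delta_symbol N h m + delta_symbol N h n) / 2 - K\<^sup>2 \<le> scheme_symbol K N h m n"
proof -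
  let ?s = "delta_symbol N h m" and ?t = "delta_symbol N h n"
  define k where "k = (K * h)\<^sup>2"
  have k: "0 \<le> k" "k \<le> 1" using assms by (auto simp: k_def abs_square_le_1)
  have kk: "k * k \<le> k" using k by (simp add: mult_left_le)
  have K: "K\<^sup>2 * h\<^sup>2 = k" "K ^ 4 * h ^ 4 = k * k" "K ^ 6 * h ^ 6 = k * k * k"
    by (simp_all add: k_def eval_nat_numeral mult_ac)
  have a1: "1 \<le> alpha1 K h" using k by (simp add: alpha1_def K)
  have a3: "alpha3 K h \<le> 1" using k kk by (simp add: alpha3_def K)
  have "1 + k / 30 + k * k / 840 \<le> 3 / 2" using k kk by simp
  hence a2: "alpha2 K h \<le> h\<^sup>2 / 4"
    using mult_left_mono[of "1 + k / 30 + k * k / 840" "3 / 2" "h\<^sup>2 / 6"]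
    by (simp add: alpha2_def K)
  have st: "0 \<le> ?s" "0 \<le> ?t" by (rule delta_symbol_nonneg)+
  have "(?s * h\<^sup>2) * ?t \<le> 4 * ?t" "(?t * h\<^sup>2) * ?s \<le> 4 * ?s"
    by (intro mult_right_mono delta_symbol_upper st)+
  hence "h\<^sup>2 * (?s * ?t) \<le> 2 * (?s + ?t)" by (simp add: mult_ac)
  moreover have "alpha2 K h * (?s * ?t) \<le> h\<^sup>2 / 4 * (?s * ?t)"
    by (intro mult_right_mono a2) (use st in auto)
  ultimately have "alpha2 K h * ?s * ?t \<le> (?s + ?t) / 2" by (simp add: mult_ac)
  moreover have "1 * (?s + ?t) \<le> alpha1 K h * (?s + ?t)"
    by (intro mult_right_mono a1) (use st in auto)
  moreover have "K\<^sup>2 * alpha3 K h \<le> K\<^sup>2 * 1" by (intro mult_left_mono a3) auto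
  ultimately show ?thesis unfolding scheme_symbol_def by linarith
qed

lemma delta_symbol_tendsto:
  "((\<lambda>h. 4 * (sin (real m * pi * h / (2 * L)))\<^sup>2 / h\<^sup>2) \<longlongrightarrow> (real m * pi / L)\<^sup>2) (at_right 0)"
proof -
  define q where "q = real m * pi / (2 * L)"
  have "((\<lambda>h. sin (q * h)) has_real_derivative cos (q * 0) * q) (at 0)"
    by (auto intro!: derivative_eq_intros)
  hence "((\<lambda>h. sin (q * h) / h) \<longlongrightarrow> q) (at 0)"
    by (simp add: DERIV_def)
  hence "((\<lambda>h. sin (q * h) / h) \<longlongrightarrow> q) (at_right 0)"
    by (rule tendsto_mono[rotated]) (simp add: at_within_le_at)
  hence "((\<lambda>h. 4 * (sin (q * h) / h)\<^sup>2) \<longlongrightarrow> 4 * q\<^sup>2) (at_right 0)"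
    by (intro tendsto_intros)
  moreover have "4 * q\<^sup>2 = (real m * pi / L)\<^sup>2"
    by (simp add: q_def power_divide power_mult_distrib)
  moreover have "4 * (sin (q * h) / h)\<^sup>2 = 4 * (sin (real m * pi * h / (2 * L)))\<^sup>2 / h\<^sup>2" for h
    by (simp add: q_def power_divide)
  ultimately show ?thesis by simp
qed

text \<open>
  Frequencies with \<open>m\<^sup>2 + n\<^sup>2 \<ge> 9 K\<^sup>2 L\<^sup>2\<close> are handled by the growth of the discrete Laplacian. The
  others form a finite set, on which the symbols converge to nonzero limits as \<open>h \<rightarrow> 0\<close>. Along
  grids with \<open>N h = L\<close> the symbol depends on \<open>h\<close> alone, which makes this limit meaningful.
\<close>

lemma scheme_symbol_uniformly_elliptic:
  assumes "L > 0" "K > 0"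
    and nonres: "\<And>m n :: nat. m \<ge> 1 \<Longrightarrow> n \<ge> 1 \<Longrightarrow> (real m * pi / L)\<^sup>2 + (real n * pi / L)\<^sup>2 \<noteq> K\<^sup>2"
  obtains h0 \<kappa> where "h0 > 0" "\<kappa> > 0"
    "\<And>N h m n. real N * h = L \<Longrightarrow> 0 < h \<Longrightarrow> h < h0 \<Longrightarrow> m \<in> {1..N-1} \<Longrightarrow> n \<in> {1..N-1} \<Longrightarrow>
       \<kappa> * real m * real n \<le> \<bar>scheme_symbol K N h m n\<bar>"
proof -
  define \<sigma> where "\<sigma> h m = 4 * (sin (real m * pi * h / (2 * L)))\<^sup>2 / h\<^sup>2" for h and m :: nat
  define \<Lambda> where "\<Lambda> h = (\<lambda>(m, n). alpha1 K h * (\<sigma> h m + \<sigma> h n) - alpha2 K h * \<sigma> h m * \<sigma> h n - K\<^sup>2 * alpha3 K h)" for h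
  define \<Lambda>0 where "\<Lambda>0 = (\<lambda>(m :: nat, n :: nat). (real m * pi / L)\<^sup>2 + (real n * pi / L)\<^sup>2 - K\<^sup>2)"
  have symbol: "scheme_symbol K N h m n = \<Lambda> h (m, n)" if "real N * h = L" "0 < h" for N h m n
  proof -
    have "delta_symbol N h m = \<sigma> h m" for m
      unfolding delta_symbol_def \<sigma>_def using that \<open>L > 0\<close> by (simp add: that(1)[symmetric])
    thus ?thesis by (simp add: scheme_symbol_def \<Lambda>_def)
  qed
  have lim: "((\<lambda>h. \<Lambda> h p) \<longlongrightarrow> \<Lambda>0 p) (at_right 0)" for p
  proof -
    obtain m n where p: "p = (m, n)" by fastforce
    have \<sigma>: "((\<lambda>h. \<sigma> h m) \<longlongrightarrow> (real m * pi / L)\<^sup>2) (at_right 0)" for m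
      unfolding \<sigma>_def by (rule delta_symbol_tendsto)
    have "((\<lambda>h. alpha1 K h) \<longlongrightarrow> 1 + K ^ 6 * 0 ^ 6 / 20160) (at_right 0)"
      "((\<lambda>h. alpha2 K h) \<longlongrightarrow> 0\<^sup>2 / 6 * (1 + K\<^sup>2 * 0\<^sup>2 / 30 + K ^ 4 * 0 ^ 4 / 840)) (at_right 0)"
      "((\<lambda>h. alpha3 K h) \<longlongrightarrow> 1 - K\<^sup>2 * 0\<^sup>2 / 12 + K ^ 4 * 0 ^ 4 / 360) (at_right 0)"
      unfolding alpha1_def alpha2_def alpha3_def by (intro tendsto_intros; simp)+
    from tendsto_diff[OF tendsto_diff[OF tendsto_mult[OF this(1) tendsto_add[OF \<sigma>[of m] \<sigma>[of n]]]
        tendsto_mult[OF tendsto_mult[OF this(2) \<sigma>[of m]] \<sigma>[of n]]]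
        tendsto_mult[OF tendsto_const[of "K\<^sup>2"] this(3)]]
    show ?thesis by (simp add: p \<Lambda>_def \<Lambda>0_def)
  qed
  \<comment> \<open>beyond this threshold \<open>K\<^sup>2\<close> is at most half of the lower bound for the Laplacian part\<close>
  define Low where "Low = {(m :: nat, n :: nat). m \<ge> 1 \<and> n \<ge> 1 \<and> (real m)\<^sup>2 + (real n)\<^sup>2 < 9 * K\<^sup>2 * L\<^sup>2}"
  have fin: "finite Low"
  proof (rule finite_subset)
    have "m \<le> nat \<lceil>9 * K\<^sup>2 * L\<^sup>2\<rceil>" if "(real m)\<^sup>2 < 9 * K\<^sup>2 * L\<^sup>2" for m
    proof -
      have "real m \<le> (real m)\<^sup>2" by (cases m) (auto simp: power2_eq_square)
      thus ?thesis using that by linarith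
    qed
    moreover have "(real m)\<^sup>2 < 9 * K\<^sup>2 * L\<^sup>2" "(real n)\<^sup>2 < 9 * K\<^sup>2 * L\<^sup>2" if "(m, n) \<in> Low" for m n
    proof -
      have "(real m)\<^sup>2 + (real n)\<^sup>2 < 9 * K\<^sup>2 * L\<^sup>2" using that by (simp add: Low_def)
      thus "(real m)\<^sup>2 < 9 * K\<^sup>2 * L\<^sup>2" "(real n)\<^sup>2 < 9 * K\<^sup>2 * L\<^sup>2"
        using zero_le_power2[of "real m"] zero_le_power2[of "real n"] by linarith+
    qed
    ultimately show "Low \<subseteq> {..nat \<lceil>9 * K\<^sup>2 * L\<^sup>2\<rceil>} \<times> {..nat \<lceil>9 * K\<^sup>2 * L\<^sup>2\<rceil>}" by force
  qed auto
  have pos0: "0 < \<bar>\<Lambda>0 p\<bar>" if "p \<in> Low" for p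
    using that nonres by (auto simp: Low_def \<Lambda>0_def)
  have "eventually (\<lambda>h. \<forall>p\<in>Low. \<bar>\<Lambda>0 p\<bar> / 2 < \<bar>\<Lambda> h p\<bar>) (at_right 0)"
  proof (intro eventually_ball_finite[OF fin] ballI)
    fix p assume "p \<in> Low"
    show "eventually (\<lambda>h. \<bar>\<Lambda>0 p\<bar> / 2 < \<bar>\<Lambda> h p\<bar>) (at_right 0)"
      by (rule order_tendstoD(1)[OF tendsto_rabs[OF lim]]) (use pos0[OF \<open>p \<in> Low\<close>] in simp)
  qed
  then obtain h1 where h1: "h1 > 0" "\<And>h p. 0 < h \<Longrightarrow> h < h1 \<Longrightarrow> p \<in> Low \<Longrightarrow> \<bar>\<Lambda>0 p\<bar> / 2 < \<bar>\<Lambda> h p\<bar>"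
    unfolding eventually_at_right_field by blast
  define Q where "Q = insert (2 / (9 * L\<^sup>2)) ((\<lambda>p. \<bar>\<Lambda>0 p\<bar> / 2 / (real (fst p) * real (snd p))) ` Low)"
  define \<kappa> where "\<kappa> = Min Q"
  have Q: "finite Q" "Q \<noteq> {}" using fin by (auto simp: Q_def)
  have "\<forall>q\<in>Q. 0 < q"
    using pos0 \<open>L > 0\<close> by (auto simp: Q_def Low_def)
  hence \<kappa>: "\<kappa> > 0" using Q by (simp add: \<kappa>_def)
  have \<kappa>_le: "\<kappa> \<le> q" if "q \<in> Q" for q using that Q by (simp add: \<kappa>_def)
  show ?thesis
  \<comment> \<open>\<open>h < 1 / K\<close> is the condition \<open>K h \<le> 1\<close> under which the high frequencies are controlled\<close>
  proof (rule that[of "min h1 (1 / K)" \<kappa>])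
    show "0 < min h1 (1 / K)" using h1(1) \<open>K > 0\<close> by simp
    fix N h m n assume *: "real N * h = L" "0 < h" "h < min h1 (1 / K)" "m \<in> {1..N-1}" "n \<in> {1..N-1}"
    have mn: "0 < real m * real n" using * by auto
    show "\<kappa> * real m * real n \<le> \<bar>scheme_symbol K N h m n\<bar>"
    proof (cases "(m, n) \<in> Low")
      case True
      have "\<kappa> \<le> \<bar>\<Lambda>0 (m, n)\<bar> / 2 / (real m * real n)"
        by (rule \<kappa>_le) (use True in \<open>force simp: Q_def\<close>)
      hence "\<kappa> * (real m * real n) \<le> \<bar>\<Lambda>0 (m, n)\<bar> / 2"
        using mn by (simp add: pos_le_divide_eq)
      also have "\<dots> < \<bar>\<Lambda> h (m, n)\<bar>" by (rule h1(2)) (use * True in auto)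
      finally show ?thesis by (simp add: symbol[OF *(1,2)] mult_ac)
    next
      case False
      hence "9 * K\<^sup>2 * L\<^sup>2 \<le> (real m)\<^sup>2 + (real n)\<^sup>2" using * by (auto simp: Low_def)
      hence K2: "K\<^sup>2 \<le> ((real m)\<^sup>2 + (real n)\<^sup>2) / (9 * L\<^sup>2)"
        using \<open>L > 0\<close> by (simp add: pos_le_divide_eq mult_ac)
      have "\<kappa> * (real m * real n) \<le> 2 / (9 * L\<^sup>2) * (real m * real n)"
        by (intro mult_right_mono \<kappa>_le) (use mn in \<open>auto simp: Q_def\<close>)
      also have "\<dots> = (2 * real m * real n) / (9 * L\<^sup>2)" by simp
      also have "\<dots> \<le> ((real m)\<^sup>2 + (real n)\<^sup>2) / (9 * L\<^sup>2)"
        by (intro divide_right_mono sum_squares_bound) simp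
      also have "\<dots> \<le> (4 / 9 * (real m)\<^sup>2 / L\<^sup>2 + 4 / 9 * (real n)\<^sup>2 / L\<^sup>2) / 2 - K\<^sup>2"
        using K2 by (simp add: add_divide_distrib)
      also have "\<dots> \<le> (delta_symbol N h m + delta_symbol N h n) / 2 - K\<^sup>2"
      proof -
        have "m \<le> N" "n \<le> N" "N > 0" using *(4,5) by auto
        thus ?thesis
          using delta_symbol_lower[OF *(1,2), of m] delta_symbol_lower[OF *(1,2), of n] by simp
      qed
      also have "\<dots> \<le> scheme_symbol K N h m n"
        by (rule scheme_symbol_lower) (use * \<open>K > 0\<close> in \<open>simp add: field_simps\<close>)
      finally show ?thesis by (simp add: mult_ac)
    qed
  qed (rule \<kappa>)
qed


section \<open>Uniqueness excludes resonance\<close>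

text \<open>
  The mixed partial derivatives of \<open>sin (p (x - a)) sin (q (y - c))\<close>; a derivative of a sine is a
  phase shift by \<open>\<pi> / 2\<close>, which gives one formula for all orders.
\<close>

definition sine_wave :: "real \<Rightarrow> real \<Rightarrow> real \<Rightarrow> real \<Rightarrow> nat \<Rightarrow> nat \<Rightarrow> real \<Rightarrow> real \<Rightarrow> real" where
  "sine_wave a c p q k l x y =
     (p ^ k * sin (p * (x - a) + real k * (pi / 2))) * (q ^ l * sin (q * (y - c) + real l * (pi / 2)))"

lemma sine_wave_partials_upto: "partials_upto n a b c d (sine_wave a c p q)"
proof -
  have deriv: "((\<lambda>s. r ^ i * sin (r * (s - e) + real i * (pi / 2))) has_real_derivative
      r ^ Suc i * sin (r * (z - e) + real (Suc i) * (pi / 2))) (at z within S)" for r i e z S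
  proof -
    have "((\<lambda>s. r ^ i * sin (r * (s - e) + real i * (pi / 2))) has_real_derivative
        r ^ i * (cos (r * (z - e) + real i * (pi / 2)) * r)) (at z within S)"
      by (auto intro!: derivative_eq_intros)
    moreover have "sin (r * (z - e) + real (Suc i) * (pi / 2)) = cos (r * (z - e) + real i * (pi / 2))"
    proof -
      have "r * (z - e) + real (Suc i) * (pi / 2) = (r * (z - e) + real i * (pi / 2)) + pi / 2"
        by (simp add: algebra_simps add_divide_distrib)
      thus ?thesis by (simp only: sin_add sin_pi_half cos_pi_half)
    qed
    ultimately show ?thesis by (simp add: mult_ac)
  qed
  show ?thesis
    unfolding partials_upto_def sine_wave_def
    by (intro allI impI ballI conjI DERIV_cmult DERIV_cmult_right deriv)
qed

lemma sine_wave_continuous: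
  "continuous_on S (\<lambda>p. sine_wave a c r q k l (fst p) (snd p))"
  unfolding sine_wave_def by (intro continuous_intros)

lemma frontier_rectangle_iff:
  fixes a b c d x y :: real
  shows "(x, y) \<in> frontier ({a..b} \<times> {c..d}) \<longleftrightarrow>
     x \<in> {a..b} \<and> y \<in> {c..d} \<and> (x = a \<or> x = b \<or> y = c \<or> y = d)"
  by (auto simp: frontier_def closure_Times interior_Times)

text \<open>
  In case of resonance the sine wave solves the homogeneous problem, so \<open>u\<close> plus the wave is again
  a solution. It differs from \<open>u\<close> where both sines equal 1.
\<close>

lemma uniqueness_imp_nonresonance:
  assumes "a < b" "c < d" "b - a = L" "d - c = L"
    and u: "helmholtz_dirichlet a b c d K f \<Phi> u"
    and unique: "\<forall>v. helmholtz_dirichlet a b c d K f \<Phi> v \<longrightarrow> (\<forall>p\<in>{a..b} \<times> {c..d}. v p = u p)"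
    and mn: "m \<ge> 1" "n \<ge> (1 :: nat)"
  shows "(real m * pi / L)\<^sup>2 + (real n * pi / L)\<^sup>2 \<noteq> K\<^sup>2"
proof
  assume res: "(real m * pi / L)\<^sup>2 + (real n * pi / L)\<^sup>2 = K\<^sup>2"
  define r where "r = real m * pi / L"
  define q where "q = real n * pi / L"
  let ?W = "sine_wave a c r q"
  have L: "L > 0" using assms(1,3) by simp
  have uC: "Ck_rect 8 a b c d u" using u by (simp add: helmholtz_dirichlet_def)
  define U where "U = mixed_partial a b c d u"
  have U: "partials_upto 8 a b c d U" unfolding U_def by (rule mixed_partial_partials_upto[OF assms(1,2) uC])
  have u0: "u (x, y) = U 0 0 x y" for x y by (simp add: U_def mixed_partial_def)
  define V where "V k l x y = U k l x y + ?W k l x y" for k l x y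
  have V: "partials_upto 8 a b c d V"
    unfolding partials_upto_def V_def
    by (intro allI impI ballI conjI DERIV_add partials_upto_x[OF U] partials_upto_y[OF U]
        partials_upto_x[OF sine_wave_partials_upto[of 8]] partials_upto_y[OF sine_wave_partials_upto[of 8]])
  define v where "v p = V 0 0 (fst p) (snd p)" for p
  have v0: "v (x, y) = V 0 0 x y" for x y by (simp add: v_def)
  have "helmholtz_dirichlet a b c d K f \<Phi> v"
    unfolding helmholtz_dirichlet_def
  proof (intro conjI ballI)
    have "continuous_on ({a..b} \<times> {c..d}) (\<lambda>p. V k l (fst p) (snd p))" if "k + l \<le> 8" for k l
      unfolding V_def U_def
      by (intro continuous_on_add mixed_partial_continuous[OF uC that] sine_wave_continuous)
    thus "Ck_rect 8 a b c d v"
      by (rule Ck_rect_of_partials[OF assms(1,2) V, of 0 0]) (simp_all add: v0)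
  next
    fix p assume p: "p \<in> {a<..<b} \<times> {c<..<d}"
    then obtain x y where xy: "p = (x, y)" "x \<in> {a..b}" "y \<in> {c..d}" by (cases p) auto
    have "pdx2 a b v (x, y) = V (Suc (Suc 0)) 0 x y" "pdy2 c d v (x, y) = V 0 (Suc (Suc 0)) x y"
      "pdx2 a b u (x, y) = U (Suc (Suc 0)) 0 x y" "pdy2 c d u (x, y) = U 0 (Suc (Suc 0)) x y"
      by (rule pdx2_eq_partial[OF assms(1) V _ v0 xy(2,3)] pdy2_eq_partial[OF assms(2) V _ v0 xy(2,3)]
            pdx2_eq_partial[OF assms(1) U _ u0 xy(2,3)] pdy2_eq_partial[OF assms(2) U _ u0 xy(2,3)]; simp)+
    moreover have "?W (Suc (Suc 0)) 0 x y = - (r\<^sup>2 * ?W 0 0 x y)"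
      "?W 0 (Suc (Suc 0)) x y = - (q\<^sup>2 * ?W 0 0 x y)"
      by (simp_all add: sine_wave_def power2_eq_square)
    hence "?W (Suc (Suc 0)) 0 x y + ?W 0 (Suc (Suc 0)) x y + K\<^sup>2 * ?W 0 0 x y = 0"
      unfolding res[symmetric] r_def[symmetric] q_def[symmetric]
      by (simp add: algebra_simps)
    moreover have "pdx2 a b u p + pdy2 c d u p + K\<^sup>2 * u p = f p"
      using u p unfolding helmholtz_dirichlet_def by blast
    ultimately show "pdx2 a b v p + pdy2 c d v p + K\<^sup>2 * v p = f p"
      by (simp add: xy(1) v0 u0 V_def algebra_simps)
  next
    fix p assume p: "p \<in> frontier ({a..b} \<times> {c..d})"
    obtain x y where xy: "p = (x, y)" by fastforce
    have "x = a \<or> x = b \<or> y = c \<or> y = d"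
      using p unfolding xy frontier_rectangle_iff by blast
    moreover have "r * (b - a) = real m * pi" "q * (d - c) = real n * pi"
      using assms(3,4) L by (simp_all add: r_def q_def)
    ultimately have "?W 0 0 x y = 0" by (auto simp: sine_wave_def)
    moreover have "u p = \<Phi> p" using u p unfolding helmholtz_dirichlet_def by blast
    ultimately show "v p = \<Phi> p" by (simp add: xy v0 V_def u0)
  qed
  hence "\<forall>p\<in>{a..b} \<times> {c..d}. v p = u p" using unique by blast
  moreover define x where "x = a + L / (2 * real m)"
  define y where "y = c + L / (2 * real n)"
  have half: "L / (2 * real i) \<le> L" if "i \<ge> 1" for i
    using that L by (simp add: field_simps)
  have "(x, y) \<in> {a..b} \<times> {c..d}"
    using half[OF mn(1)] half[OF mn(2)] L assms(3,4) by (auto simp: x_def y_def)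
  ultimately have "?W 0 0 x y = 0" by (auto simp: v0 u0 V_def)
  moreover have "r * (x - a) = pi / 2" "q * (y - c) = pi / 2"
    using mn L by (simp_all add: r_def q_def x_def y_def)
  ultimately show False by (simp add: sine_wave_def)
qed


section \<open>Convergence\<close>

text \<open>
  The equation is given in the open rectangle, while the difference stencils next to the boundary
  evaluate \<open>f\<close> and its derivatives on the edges. Both sides are continuous, so the equation extends.
\<close>

lemma helmholtz_closed_rectangle:
  assumes "a < b" "c < d" and u: "Ck_rect 8 a b c d u" and f: "continuous_on ({a..b} \<times> {c..d}) f"
    and pde: "\<forall>p\<in>{a<..<b} \<times> {c<..<d}. pdx2 a b u p + pdy2 c d u p + K\<^sup>2 * u p = f p"
    and xy: "x \<in> {a..b}" "y \<in> {c..d}"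
  shows "f (x, y) = helmholtz_family K (mixed_partial a b c d u) 0 0 x y"
proof -
  let ?G = "mixed_partial a b c d u"
  have G: "partials_upto 8 a b c d ?G" by (rule mixed_partial_partials_upto[OF assms(1,2) u])
  have u0: "u (x, y) = ?G 0 0 x y" for x y by (simp add: mixed_partial_def)
  define e where "e p = f p - helmholtz_family K ?G 0 0 (fst p) (snd p)" for p
  have cl: "closure ({a<..<b} \<times> {c<..<d}) = {a..b} \<times> {c..d}"
    using assms(1,2) by (simp add: closure_Times)
  have "e (x, y) = 0"
  proof (rule continuous_constant_on_closure[where S = "{a<..<b} \<times> {c<..<d}" and f = e])
    show "continuous_on (closure ({a<..<b} \<times> {c<..<d})) e"
      unfolding cl e_def helmholtz_family_def
      by (intro continuous_on_diff continuous_on_add continuous_on_mult continuous_on_const f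
          mixed_partial_continuous[OF u]) simp_all
    show "(x, y) \<in> closure ({a<..<b} \<times> {c<..<d})" using cl xy by simp
    show "e p = 0" if pin: "p \<in> {a<..<b} \<times> {c<..<d}" for p
    proof -
      obtain x y where p: "p = (x, y)" and xy: "x \<in> {a..b}" "y \<in> {c..d}"
        using pin by (cases p) auto
      have "pdx2 a b u p = ?G (Suc (Suc 0)) 0 x y"
        unfolding p by (rule pdx2_eq_partial[OF assms(1) G]) (use u0 xy in auto)
      moreover have "pdy2 c d u p = ?G 0 (Suc (Suc 0)) x y"
        unfolding p by (rule pdy2_eq_partial[OF assms(2) G]) (use u0 xy in auto)
      ultimately show ?thesis
        using bspec[OF pde pin] by (simp add: e_def helmholtz_family_def p u0 numeral_2_eq_2)
    qed
  qed
  thus ?thesis by (simp add: e_def)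
qed

lemma delta_x2_grid:
  assumes "\<And>i. i \<le> N \<Longrightarrow> \<phi> i j = g (a + real i * h)" "i \<in> {1..N-1}"
  shows "delta_x2 h \<phi> i j = second_difference h g (a + real i * h)"
proof -
  have "a + real (i - 1) * h = a + real i * h - h" "a + real (i + 1) * h = a + real i * h + h"
    using assms(2) by (auto simp: of_nat_diff algebra_simps)
  moreover have "\<phi> (i - 1) j = g (a + real (i - 1) * h)" "\<phi> i j = g (a + real i * h)"
    "\<phi> (i + 1) j = g (a + real (i + 1) * h)"
    by (rule assms(1); use assms(2) in auto)+
  ultimately show ?thesis
    by (simp only: delta_x2_def second_difference_def)
qed

lemma delta_y2_grid:
  assumes "\<And>j. j \<le> N \<Longrightarrow> \<phi> i j = g (c + real j * h)" "j \<in> {1..N-1}"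
  shows "delta_y2 h \<phi> i j = second_difference h g (c + real j * h)"
  using delta_x2_grid[of N "\<lambda>j i. \<phi> i j" i g c h j] assms
  by (simp add: delta_x2_def delta_y2_def)

lemma scheme_op_diff:
  "scheme_op K h (\<lambda>i j. \<phi> i j - \<psi> i j) i j = scheme_op K h \<phi> i j - scheme_op K h \<psi> i j"
  by (simp add: scheme_op_def delta_x2_def delta_y2_def diff_divide_distrib add_divide_distrib algebra_simps)

lemma uniform_grid_mesh_square:
  assumes "uniform_grid a b c d N h" "i \<in> {1..N-1}" "j \<in> {1..N-1}"
  shows "mesh_square a b c d h (a + real i * h) (c + real j * h)"
proof -
  have h: "h > 0" and b: "b = a + real N * h" and d: "d = c + real N * h"
    using assms(1) by (auto simp: uniform_grid_def)
  have "h \<le> real i * h" "real i * h + h \<le> real N * h" if "i \<in> {1..N-1}" for i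
  proof -
    have "1 * h \<le> real i * h" "(real i + 1) * h \<le> real N * h"
      using that h by (intro mult_right_mono; auto)+
    thus "h \<le> real i * h" "real i * h + h \<le> real N * h" by (simp_all add: algebra_simps)
  qed
  from this[OF assms(2)] this[OF assms(3)] show ?thesis
    using h by (simp add: mesh_square_def b d)
qed

lemma uniform_grid_in_rectangle:
  assumes "uniform_grid a b c d N h" "i \<le> N"
  shows "a + real i * h \<in> {a..b}" "c + real i * h \<in> {c..d}"
proof -
  have h: "h > 0" and b: "b = a + real N * h" and d: "d = c + real N * h"
    using assms(1) by (auto simp: uniform_grid_def)
  have "real i * h \<le> real N * h" using assms(2) h by (intro mult_right_mono) auto
  thus "a + real i * h \<in> {a..b}" "c + real i * h \<in> {c..d}" using h by (simp_all add: b d)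
qed

text \<open>
  On the closed rectangle the derivatives of \<open>f\<close> in the right-hand side of the scheme are those of
  \<open>\<Delta>u + K\<^sup>2 u\<close>, so the bound for the truncation error applies at every interior grid point.
\<close>

lemma scheme_consistency:
  assumes "a < b" "c < d" and f: "Ck_rect 6 a b c d f"
    and u: "helmholtz_dirichlet a b c d K f \<Phi> u"
  obtains T where "\<And>N h i j. uniform_grid a b c d N h \<Longrightarrow> i \<in> {1..N-1} \<Longrightarrow> j \<in> {1..N-1} \<Longrightarrow>
    \<bar>scheme_op K h (\<lambda>i j. u (grid_point a c h i j)) i j - scheme_rhs a b c d K h f i j\<bar> \<le> T * h ^ 6"
proof -
  have uC: "Ck_rect 8 a b c d u"
    and pde: "\<forall>p\<in>{a<..<b} \<times> {c<..<d}. pdx2 a b u p + pdy2 c d u p + K\<^sup>2 * u p = f p"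
    using u by (auto simp: helmholtz_dirichlet_def)
  define G where "G = mixed_partial a b c d u"
  define F where "F = helmholtz_family K G"
  have G: "partials_upto 8 a b c d G" unfolding G_def by (rule mixed_partial_partials_upto[OF assms(1,2) uC])
  hence F: "partials_upto 6 a b c d F" unfolding F_def by (intro helmholtz_family_partials_upto) simp
  obtain M where M: "bounded_upto 8 M a b c d G"
    unfolding G_def using mixed_partial_bounded_upto[OF uC] .
  have u0: "u (x, y) = G 0 0 x y" for x y by (simp add: G_def mixed_partial_def)
  have f0: "f (x, y) = F 0 0 x y" if "x \<in> {a..b}" "y \<in> {c..d}" for x y
    unfolding F_def G_def by (rule helmholtz_closed_rectangle[OF assms(1,2) uC Ck_rect_continuous[OF f] pde that])
  have fxx: "pdx2 a b f (x, y) = F 2 0 x y" if "x \<in> {a..b}" "y \<in> {c..d}" for x y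
    using pdx2_eq_partial[OF assms(1) F _ f0 that] by (simp add: numeral_2_eq_2)
  have fyy: "pdy2 c d f (x, y) = F 0 2 x y" if "x \<in> {a..b}" "y \<in> {c..d}" for x y
    using pdy2_eq_partial[OF assms(2) F _ f0 that] by (simp add: numeral_2_eq_2)
  obtain T where T: "\<And>h x y. mesh_square a b c d h x y \<Longrightarrow>
    \<bar>- alpha1 K h * (second_difference h (\<lambda>s. G 0 0 s y) x + second_difference h (G 0 0 x) y)
       - alpha2 K h * second_difference h (\<lambda>s. second_difference h (G 0 0 s) y) x
       - K\<^sup>2 * alpha3 K h * G 0 0 x y
     - (- beta1 K h * F 0 0 x y
        - beta2 K h * (second_difference h (\<lambda>s. F 0 0 s y) x + second_difference h (F 0 0 x) y)
        - beta3 K h * second_difference h (\<lambda>s. second_difference h (F 0 0 s) y) x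
        - beta4 K h * (F 2 0 x y + F 0 2 x y)
        - beta5 K h * (second_difference h (\<lambda>s. F 2 0 s y) x + second_difference h (F 0 2 x) y))\<bar>
     \<le> T * h ^ 6"
    unfolding F_def using truncation_error_sixth_order[OF G M, of K] by blast
  show ?thesis
  proof (rule that)
    fix N h i j assume grid: "uniform_grid a b c d N h" and ij: "i \<in> {1..N-1}" "j \<in> {1..N-1}"
    let ?x = "\<lambda>i. a + real i * h" and ?y = "\<lambda>j. c + real j * h"
    note rect = uniform_grid_in_rectangle[OF grid]
    have ijN: "i \<le> N" "j \<le> N" using ij by auto
    have x: "delta_x2 h (\<lambda>i j. \<phi> (grid_point a c h i j)) i j = second_difference h (\<lambda>s. H s (?y j)) (?x i)"
      if "\<And>x y. x \<in> {a..b} \<Longrightarrow> y \<in> {c..d} \<Longrightarrow> \<phi> (x, y) = H x y" for \<phi> and H :: "real \<Rightarrow> real \<Rightarrow> real"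
      by (rule delta_x2_grid[OF _ ij(1)]) (simp only: grid_point_def that rect ijN)
    have y: "delta_y2 h (\<lambda>i j. \<phi> (grid_point a c h i j)) k j = second_difference h (H (?x k)) (?y j)"
      if "\<And>x y. x \<in> {a..b} \<Longrightarrow> y \<in> {c..d} \<Longrightarrow> \<phi> (x, y) = H x y" "k \<le> N"
      for \<phi> k and H :: "real \<Rightarrow> real \<Rightarrow> real"
      by (rule delta_y2_grid[OF _ ij(2)]) (simp only: grid_point_def that rect)
    have xy: "delta_x2 h (delta_y2 h (\<lambda>i j. \<phi> (grid_point a c h i j))) i j
        = second_difference h (\<lambda>s. second_difference h (H s) (?y j)) (?x i)"
      if "\<And>x y. x \<in> {a..b} \<Longrightarrow> y \<in> {c..d} \<Longrightarrow> \<phi> (x, y) = H x y" for \<phi> and H :: "real \<Rightarrow> real \<Rightarrow> real"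
      by (rule delta_x2_grid[OF _ ij(1)], rule y[of \<phi> H], erule (1) that, assumption)
    let ?g = "\<lambda>\<phi> i j. \<phi> (grid_point a c h i j)"
    have u_diff: "delta_x2 h (?g u) i j = second_difference h (\<lambda>s. G 0 0 s (?y j)) (?x i)"
      "delta_y2 h (?g u) i j = second_difference h (G 0 0 (?x i)) (?y j)"
      "delta_x2 h (delta_y2 h (?g u)) i j
         = second_difference h (\<lambda>s. second_difference h (G 0 0 s) (?y j)) (?x i)"
      by (rule x xy y[OF _ ijN(1)], rule u0)+
    have f_diff: "delta_x2 h (?g f) i j = second_difference h (\<lambda>s. F 0 0 s (?y j)) (?x i)"
      "delta_y2 h (?g f) i j = second_difference h (F 0 0 (?x i)) (?y j)"
      "delta_x2 h (delta_y2 h (?g f)) i j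
         = second_difference h (\<lambda>s. second_difference h (F 0 0 s) (?y j)) (?x i)"
      by (rule x xy y[OF _ ijN(1)], erule (1) f0)+
    have f2_diff: "delta_x2 h (?g (pdx2 a b f)) i j = second_difference h (\<lambda>s. F 2 0 s (?y j)) (?x i)"
      "delta_y2 h (?g (pdy2 c d f)) i j = second_difference h (F 0 2 (?x i)) (?y j)"
      by (rule x, erule (1) fxx) (rule y[OF _ ijN(1)], erule (1) fyy)
    show "\<bar>scheme_op K h (?g u) i j - scheme_rhs a b c d K h f i j\<bar> \<le> T * h ^ 6"
      using T[OF uniform_grid_mesh_square[OF grid ij]]
      unfolding scheme_op_def scheme_rhs_def Let_def u_diff f_diff f2_diff
      by (simp only: grid_point_def u0 f0 fxx fyy rect ijN)
  qed
qed

lemma max_error_le: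
  assumes "\<And>i j. i \<le> N \<Longrightarrow> j \<le> N \<Longrightarrow> \<bar>u (grid_point a c h i j) - U i j\<bar> \<le> B"
  shows "max_error a c N h u U \<le> B"
  unfolding max_error_def by (rule Max.boundedI) (use assms in auto)

lemma max_error_nonneg: "0 \<le> max_error a c N h u U"
proof -
  have "\<bar>u (grid_point a c h 0 0) - U 0 0\<bar> \<le> max_error a c N h u U"
    unfolding max_error_def by (rule Max_ge) force+
  thus ?thesis by linarith
qed

lemma scheme_error_bound:
  assumes "a < b" "c < d" and f: "Ck_rect 6 a b c d f"
    and u: "helmholtz_dirichlet a b c d K f \<Phi> u" and "K > 0"
    and unique: "\<forall>v. helmholtz_dirichlet a b c d K f \<Phi> v \<longrightarrow> (\<forall>p\<in>{a..b} \<times> {c..d}. v p = u p)"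
  obtains h0 C where "h0 > 0"
    "\<And>N h U. uniform_grid a b c d N h \<Longrightarrow> h < h0 \<Longrightarrow> scheme_solution a b c d K f \<Phi> N h U \<Longrightarrow>
       max_error a c N h u U \<le> C * h ^ 6"
proof (cases "b - a = d - c")
  case False
  hence no_grid: "\<not> uniform_grid a b c d N h" for N h by (auto simp: uniform_grid_def)
  show ?thesis by (rule that[of 1 0]) (simp_all add: no_grid)
next
  case True
  define L where "L = b - a"
  have nonres: "(real m * pi / L)\<^sup>2 + (real n * pi / L)\<^sup>2 \<noteq> K\<^sup>2" if "m \<ge> 1" "n \<ge> 1" for m n :: nat
    by (rule uniqueness_imp_nonresonance[OF assms(1,2) _ _ u unique that]) (simp_all add: L_def True)
  have "L > 0" using \<open>a < b\<close> by (simp add: L_def)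
  obtain h0 \<kappa> where h0: "h0 > 0" and \<kappa>: "\<kappa> > 0"
    and elliptic: "\<And>N h m n. real N * h = L \<Longrightarrow> 0 < h \<Longrightarrow> h < h0 \<Longrightarrow> m \<in> {1..N-1} \<Longrightarrow> n \<in> {1..N-1} \<Longrightarrow>
       \<kappa> * real m * real n \<le> \<bar>scheme_symbol K N h m n\<bar>"
    using scheme_symbol_uniformly_elliptic[OF \<open>L > 0\<close> \<open>K > 0\<close> nonres] by metis
  obtain T where T: "\<And>N h i j. uniform_grid a b c d N h \<Longrightarrow> i \<in> {1..N-1} \<Longrightarrow> j \<in> {1..N-1} \<Longrightarrow>
    \<bar>scheme_op K h (\<lambda>i j. u (grid_point a c h i j)) i j - scheme_rhs a b c d K h f i j\<bar> \<le> T * h ^ 6"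
    using scheme_consistency[OF assms(1,2) f u] by blast
  show ?thesis
  proof (rule that[OF h0])
    fix N h U
    assume grid: "uniform_grid a b c d N h" and "h < h0" and U: "scheme_solution a b c d K f \<Phi> N h U"
    have h: "h > 0" and N: "real N * h = L"
      using grid by (auto simp: uniform_grid_def L_def)
    define e where "e i j = u (grid_point a c h i j) - U i j" for i j
    have bdry: "zero_boundary N e"
      unfolding zero_boundary_def
    proof (intro ballI impI)
      fix i j assume ij: "i \<in> {0..N}" "j \<in> {0..N}" "i = 0 \<or> i = N \<or> j = 0 \<or> j = N"
      have "a + real N * h = b" "c + real N * h = d"
        using grid by (auto simp: uniform_grid_def)
      hence "grid_point a c h i j \<in> frontier ({a..b} \<times> {c..d})"
        using ij uniform_grid_in_rectangle[OF grid, of i] uniform_grid_in_rectangle[OF grid, of j]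
        unfolding grid_point_def frontier_rectangle_iff by auto
      hence "u (grid_point a c h i j) = \<Phi> (grid_point a c h i j)"
        using u unfolding helmholtz_dirichlet_def by blast
      moreover have "U i j = \<Phi> (grid_point a c h i j)"
        using U ij unfolding scheme_solution_def by blast
      ultimately show "e i j = 0" by (simp add: e_def)
    qed
    have interior: "\<bar>e i j\<bar> \<le> 4 * (\<bar>T\<bar> * h ^ 6) / \<kappa>" if ij: "i \<in> {1..N-1}" "j \<in> {1..N-1}" for i j
    proof (rule scheme_stability[OF bdry \<kappa> _ _ ij])
      show "\<kappa> * real m * real n \<le> \<bar>scheme_symbol K N h m n\<bar>" if "m \<in> {1..N-1}" "n \<in> {1..N-1}" for m n
        by (rule elliptic[OF N h \<open>h < h0\<close> that])
      show "\<bar>scheme_op K h e i j\<bar> \<le> \<bar>T\<bar> * h ^ 6" if ij: "i \<in> {1..N-1}" "j \<in> {1..N-1}" for i j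
      proof -
        have "scheme_op K h U i j = scheme_rhs a b c d K h f i j"
          using U ij unfolding scheme_solution_def by blast
        hence "\<bar>scheme_op K h e i j\<bar> \<le> T * h ^ 6"
          using T[OF grid ij] unfolding e_def scheme_op_diff by simp
        also have "\<dots> \<le> \<bar>T\<bar> * h ^ 6" using h by (intro mult_right_mono) auto
        finally show ?thesis .
      qed
    qed
    have "\<bar>e i j\<bar> \<le> 4 * \<bar>T\<bar> / \<kappa> * h ^ 6" if ij: "i \<in> {0..N}" "j \<in> {0..N}" for i j
    proof (cases "i = 0 \<or> i = N \<or> j = 0 \<or> j = N")
      case True
      hence "e i j = 0" using bdry ij unfolding zero_boundary_def by blast
      thus ?thesis using \<kappa> h by simp
    next
      case False
      hence "i \<in> {1..N-1}" "j \<in> {1..N-1}" using ij by auto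
      from interior[OF this] show ?thesis by simp
    qed
    thus "max_error a c N h u U \<le> 4 * \<bar>T\<bar> / \<kappa> * h ^ 6"
      unfolding e_def by (intro max_error_le) simp
  qed
qed

theorem theorem4p8:
  fixes a b c d K :: real
    and f \<Phi> u :: "real \<times> real \<Rightarrow> real"
  assumes "a < b" and "c < d"
    and "Ck_rect 6 a b c d f"
    and "helmholtz_dirichlet a b c d K f \<Phi> u"
    and unique: "\<And>v. helmholtz_dirichlet a b c d K f \<Phi> v \<Longrightarrow>
                   \<forall>p\<in>{a..b} \<times> {c..d}. v p = u p"
  shows "\<exists>\<epsilon>>0.
    (\<exists>C. \<forall>N h U. uniform_grid a b c d N h \<longrightarrow> 0 < K * h \<longrightarrow> K * h < \<epsilon> \<longrightarrow>
        scheme_solution a b c d K f \<Phi> N h U \<longrightarrow>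
        max_error a c N h u U \<le> C * h^6) \<and>
    (\<forall>(N :: nat \<Rightarrow> nat) (h :: nat \<Rightarrow> real) (U :: nat \<Rightarrow> nat \<Rightarrow> nat \<Rightarrow> real).
        (\<forall>n. uniform_grid a b c d (N n) (h n) \<and> 0 < K * h n \<and> K * h n < \<epsilon> \<and>
             scheme_solution a b c d K f \<Phi> (N n) (h n) (U n)) \<longrightarrow>
        h \<longlonglongrightarrow> 0 \<longrightarrow>
        (\<lambda>n. max_error a c (N n) (h n) u (U n)) \<longlonglongrightarrow> 0)"
proof -
  have unique': "\<forall>v. helmholtz_dirichlet a b c d K f \<Phi> v \<longrightarrow> (\<forall>p\<in>{a..b} \<times> {c..d}. v p = u p)"
    using unique by blast
  obtain \<epsilon> C where "\<epsilon> > 0" and bound: "\<And>N h U. uniform_grid a b c d N h \<Longrightarrow> 0 < K * h \<Longrightarrow>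
      K * h < \<epsilon> \<Longrightarrow> scheme_solution a b c d K f \<Phi> N h U \<Longrightarrow> max_error a c N h u U \<le> C * h ^ 6"
  proof (cases "K > 0")
    case True
    obtain h0 C where *: "h0 > 0" "\<And>N h U. uniform_grid a b c d N h \<Longrightarrow> h < h0 \<Longrightarrow>
        scheme_solution a b c d K f \<Phi> N h U \<Longrightarrow> max_error a c N h u U \<le> C * h ^ 6"
      using scheme_error_bound[OF assms(1-4) True unique'] by metis
    show ?thesis
    proof (rule that[of "K * h0" C])
      show "0 < K * h0" using True *(1) by simp
      show "max_error a c N h u U \<le> C * h ^ 6"
        if "uniform_grid a b c d N h" "K * h < K * h0" "scheme_solution a b c d K f \<Phi> N h U" for N h U
        using that True by (intro *(2)) simp_all
    qed
  next
    case False
    show ?thesis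
    proof (rule that[of 1 0])
      show "max_error a c N h u U \<le> 0 * h ^ 6" if "uniform_grid a b c d N h" "0 < K * h" for N h U
        using False that by (simp add: uniform_grid_def zero_less_mult_iff)
    qed simp
  qed
  show ?thesis
  proof (rule exI[of _ \<epsilon>], intro conjI \<open>\<epsilon> > 0\<close> exI[of _ C] allI impI)
    show "max_error a c N h u U \<le> C * h ^ 6"
      if "uniform_grid a b c d N h" "0 < K * h" "K * h < \<epsilon>" "scheme_solution a b c d K f \<Phi> N h U" for N h U
      using that by (rule bound)
  next
    fix N :: "nat \<Rightarrow> nat" and h :: "nat \<Rightarrow> real" and U :: "nat \<Rightarrow> nat \<Rightarrow> nat \<Rightarrow> real"
    assume scheme: "\<forall>n. uniform_grid a b c d (N n) (h n) \<and> 0 < K * h n \<and> K * h n < \<epsilon> \<and>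
        scheme_solution a b c d K f \<Phi> (N n) (h n) (U n)" and "h \<longlonglongrightarrow> 0"
    have "(\<lambda>n. C * h n ^ 6) \<longlonglongrightarrow> C * 0 ^ 6"
      by (intro tendsto_intros \<open>h \<longlonglongrightarrow> 0\<close>)
    hence lim: "(\<lambda>n. C * h n ^ 6) \<longlonglongrightarrow> 0" by simp
    show "(\<lambda>n. max_error a c (N n) (h n) u (U n)) \<longlonglongrightarrow> 0"
    proof (rule tendsto_sandwich[OF _ _ tendsto_const lim])
      show "\<forall>\<^sub>F n in sequentially. 0 \<le> max_error a c (N n) (h n) u (U n)"
        by (intro always_eventually allI max_error_nonneg)
      show "\<forall>\<^sub>F n in sequentially. max_error a c (N n) (h n) u (U n) \<le> C * h n ^ 6"
      proof (intro always_eventually allI bound)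
        fix n
        show "uniform_grid a b c d (N n) (h n)" "0 < K * h n" "K * h n < \<epsilon>"
          "scheme_solution a b c d K f \<Phi> (N n) (h n) (U n)"
          using spec[OF scheme, of n] by simp_all
      qed
    qed
  qed
qed

end
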